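(* Let $\mathscr T=(V,E)$ be a rooted directed tree with root $\mathsf{root}$. For $u\in V$ and $b\in V\setminus\{u\}$, consider a weight system $\lambda_u=\{\lambda_{uv}\}$ of complex numbers and let $W_{f,g}$ be the rank one extension of the weighted join operator $W^{(b)}_{\lambda_u}$ on $\mathscr T$, where $f\in\ell^2(V)\ominus\mathscr H$ is non-zero and $g:U\to\mathbb C$ is given ($U$, $\mathscr H=\ell^2(U)$, $W_{f,g}$ and compatibility condition I are defined in the context). Suppose that $W_{f,g}$ satisfies the compatibility condition I. If $\mathscr T$ is leafless, then the following are equivalent: (i) The rank one extension $W_{f,g}$ of the weighted join operator $W^{(b)}_{\lambda_u}$ on $\mathscr T$ admits a compact resolvent. (ii) The set $\{\lambda_{uv}:v\in U\}$ has accumulation point only at $\infty$ with each of its entries appearing finitely many times, and the set $V_\prec$ of branching vertices of $\mathscr T$ is disjoint from $\mathsf{Asc}(u)$.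
   Context: Trees. A directed tree $\mathscr T=(V,E)$ is a directed graph (no loops, $V$ and $E$ nonempty) which has no circuits, is connected (ignoring orientation), and in which every non-root vertex $v$ has exactly one parent $\mathsf{par}(v)$; it is rooted if there is a unique vertex $\mathsf{root}$ without parent. Throughout $\mathrm{card}(V)=\aleph_0$. It is leafless if every vertex has at least one child; $V_\prec$ is the set of vertices with at least two children. $\mathsf{Des}(u)$ is the set of descendants of $u$, including $u$; $\mathsf{Asc}(u)=\{\mathsf{par}^{\langle n\rangle}(u):n\ge1\}$; for $v\in\mathsf{Des}(u)$, $[u,v]$ is the set of vertices of the directed path from $u$ to $v$ and $\mathsf{Des}_v(u)=\mathsf{Des}(u)\setminus[u,v]$. Rank one extension. Let $u\in V$, $b\in V\setminus\{u\}$ and $\{\lambda_{uv}\}_{v\in V}\subseteq\mathbb C$. Put $U=\mathsf{Asc}(u)\cup\mathsf{Des}_b(u)$ and $A_u=[u,b]$ if $b\in\mathsf{Des}(u)$; $U=\mathsf{Des}(u)\setminus\{u\}$ and $A_u=\mathsf{Asc}(u)\cup\{b,u\}$ otherwise. $\mathscr H=\mathscr H^{(b)}_u=\ell^2(U)\subseteq\ell^2(V)$. $D=D^{(b)}_{\lambda_u}$ is the maximally defined diagonal operator in $\mathscr H$ with $De_v=\lambda_{uv}e_v$ ($v\in U$), and $N=N^{(b)}_{\lambda_u}=e_u\otimes e_{\lambda_u,A_u}$ on $\ell^2(V)\ominus\mathscr H$, with $e_{\lambda_u,A_u}=\sum_{v\in A_u}\overline{\lambda_{uv}}e_v$ and $(x\otimes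 y)h=\langle h,y\rangle x$. (The weighted join operator is $W^{(b)}_{\lambda_u}=D\oplus N$.) The operator $f\oslash g$ has domain $\{h\in\mathscr H:\sum_{v\in U}h(v)\overline{g(v)}\text{ is convergent}\}$ and $(f\oslash g)h=\big(\sum_{v\in U}h(v)\overline{g(v)}\big)f$. $W_{f,g}$ is the operator in $\ell^2(V)$ with domain $\{(h,k):h\in\mathscr D(D)\cap\mathscr D(f\oslash g),\ k\in\ell^2(V)\ominus\mathscr H\}$ and $W_{f,g}=\begin{bmatrix}D&0\\ f\oslash g&N\end{bmatrix}$. Compatibility condition I: there is $\mu_0\in\mathbb C$ with $\inf_{v\in U}|\mu_0-\lambda_{uv}|>0$ and $\sum_{v\in U}\frac{|g(v)|^2}{|\lambda_{uv}-\mu_0|^2}<\infty$. A densely defined operator $T$ admits a compact resolvent if there exists $\lambda\in\mathbb C\setminus\sigma(T)$ such that $(T-\lambda)^{-1}$ is compact. *)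

theory Defs
  imports "HOL-Analysis.Analysis"
begin

section \<open>Directed trees\<close>

text \<open>
  A directed graph has vertex set \<open>V\<close> and edge set \<open>E\<close>; \<open>(v, w) \<in> E\<close> says that \<open>v\<close> is a parent of
  \<open>w\<close>. Acyclicity of the relation \<open>E\<close> excludes loops and circuits together.
\<close>

locale directed_tree =
  fixes V :: "'a set" and E :: "('a \<times> 'a) set"
  assumes V_nonempty: "V \<noteq> {}"
    and E_nonempty: "E \<noteq> {}"
    and edges: "E \<subseteq> V \<times> V"
    and no_circuits: "acyclic E"
    and connected: "\<And>v w. v \<in> V \<Longrightarrow> w \<in> V \<Longrightarrow> (v, w) \<in> (E \<union> E\<inverse>)\<^sup>*"
    and unique_parent: "\<And>v. v \<in> V \<Longrightarrow> \<exists>w. (w, v) \<in> E \<Longrightarrow> \<exists>!w. (w, v) \<in> E"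

locale rooted_directed_tree = directed_tree +
  assumes unique_root: "\<exists>!r. r \<in> V \<and> (\<nexists>w. (w, r) \<in> E)"

definition leafless :: "'a set \<Rightarrow> ('a \<times> 'a) set \<Rightarrow> bool" where
  "leafless V E \<longleftrightarrow> (\<forall>v\<in>V. \<exists>w. (v, w) \<in> E)"

definition branching :: "'a set \<Rightarrow> ('a \<times> 'a) set \<Rightarrow> 'a set" where
  "branching V E = {v \<in> V. \<exists>w w'. w \<noteq> w' \<and> (v, w) \<in> E \<and> (v, w') \<in> E}"

definition Des :: "('a \<times> 'a) set \<Rightarrow> 'a \<Rightarrow> 'a set" where
  "Des E u = {v. (u, v) \<in> E\<^sup>*}"

text \<open>In a directed tree, \<open>(w, u) \<in> E ^^ n\<close> says that \<open>w\<close> is the \<open>n\<close>-fold parent of \<open>u\<close>.\<close>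

definition Asc :: "('a \<times> 'a) set \<Rightarrow> 'a \<Rightarrow> 'a set" where
  "Asc E u = {w. \<exists>n\<ge>1. (w, u) \<in> E ^^ n}"

text \<open>The vertices lying on a directed path from \<open>u\<close> to \<open>v\<close>; in a directed tree there is at most
  one such path.\<close>

definition path_verts :: "('a \<times> 'a) set \<Rightarrow> 'a \<Rightarrow> 'a \<Rightarrow> 'a set" where
  "path_verts E u v = {w. (u, w) \<in> E\<^sup>* \<and> (w, v) \<in> E\<^sup>*}"


section \<open>The Hilbert space of square summable functions\<close>

text \<open>
  Vectors of \<open>\<ell>\<^sup>2(V)\<close> are functions on the whole type that vanish outside \<open>V\<close>. Thus \<open>\<ell>\<^sup>2(U)\<close> is a subset
  of \<open>\<ell>\<^sup>2(V)\<close> for \<open>U \<subseteq> V\<close>, and sums over the whole type are sums over \<open>V\<close>.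
\<close>

definition ell2 :: "'a set \<Rightarrow> ('a \<Rightarrow> complex) set" where
  "ell2 V = {h. (\<forall>v. v \<notin> V \<longrightarrow> h v = 0) \<and> (\<lambda>v. (cmod (h v))\<^sup>2) summable_on UNIV}"

definition ell2_inner :: "('a \<Rightarrow> complex) \<Rightarrow> ('a \<Rightarrow> complex) \<Rightarrow> complex" where
  "ell2_inner h k = (\<Sum>\<^sub>\<infinity>v. h v * cnj (k v))"

definition ell2_norm :: "('a \<Rightarrow> complex) \<Rightarrow> real" where
  "ell2_norm h = sqrt (\<Sum>\<^sub>\<infinity>v. (cmod (h v))\<^sup>2)"

definition ell2_dist :: "('a \<Rightarrow> complex) \<Rightarrow> ('a \<Rightarrow> complex) \<Rightarrow> real" where
  "ell2_dist h k = ell2_norm (\<lambda>v. h v - k v)"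

definition ell2_topology :: "'a set \<Rightarrow> ('a \<Rightarrow> complex) topology" where
  "ell2_topology V = Metric_space.mtopology (ell2 V) ell2_dist"

definition ominus :: "('a \<Rightarrow> complex) set \<Rightarrow> ('a \<Rightarrow> complex) set \<Rightarrow> ('a \<Rightarrow> complex) set"
    (infixl "\<ominus>" 65) where
  "H \<ominus> K = {h \<in> H. \<forall>k\<in>K. ell2_inner h k = 0}"

definition basis_vec :: "'a \<Rightarrow> 'a \<Rightarrow> complex" where
  "basis_vec v = (\<lambda>w. if w = v then 1 else 0)"

definition rank_one ::
  "('a \<Rightarrow> complex) \<Rightarrow> ('a \<Rightarrow> complex) \<Rightarrow> ('a \<Rightarrow> complex) \<Rightarrow> ('a \<Rightarrow> complex)"
    (infix "\<otimes>\<^sub>1" 70) where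
  "(x \<otimes>\<^sub>1 y) h = (\<lambda>v. ell2_inner h y * x v)"

lemma ell2_norm_nonneg: "0 \<le> ell2_norm h"
  unfolding ell2_norm_def by (intro real_sqrt_ge_zero infsum_nonneg) auto

lemma L2_set_le_ell2_norm:
  assumes "h \<in> ell2 V" "finite F"
  shows "L2_set (\<lambda>v. cmod (h v)) F \<le> ell2_norm h"
  using assms unfolding L2_set_def ell2_norm_def ell2_def
  by (intro real_sqrt_le_mono finite_sum_le_infsum) auto

lemma ell2_bound:
  assumes "\<And>v. v \<notin> V \<Longrightarrow> h v = 0"
    and "\<And>F. finite F \<Longrightarrow> L2_set (\<lambda>v. cmod (h v)) F \<le> B"
  shows "h \<in> ell2 V" "ell2_norm h \<le> B"
proof -
  have B: "0 \<le> B"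
    using assms(2)[of "{}"] by simp
  have le: "(\<Sum>v\<in>F. (cmod (h v))\<^sup>2) \<le> B\<^sup>2" if "finite F" for F
    using assms(2)[OF that] B unfolding L2_set_def by (simp add: sqrt_le_D)
  have summ: "(\<lambda>v. (cmod (h v))\<^sup>2) summable_on UNIV"
    by (rule nonneg_bdd_above_summable_on) (use le in \<open>auto intro!: bdd_aboveI2\<close>)
  then show "h \<in> ell2 V"
    using assms(1) by (auto simp: ell2_def)
  have "(\<Sum>\<^sub>\<infinity>v. (cmod (h v))\<^sup>2) \<le> B\<^sup>2"
    using summ le by (intro infsum_le_finite_sums) auto
  then show "ell2_norm h \<le> B"
    using B unfolding ell2_norm_def by (simp add: real_le_lsqrt)
qed

lemma ell2_triangle:
  assumes "h \<in> ell2 V" "k \<in> ell2 V"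
  shows "(\<lambda>v. h v + k v) \<in> ell2 V" "ell2_norm (\<lambda>v. h v + k v) \<le> ell2_norm h + ell2_norm k"
proof -
  have "L2_set (\<lambda>v. cmod (h v + k v)) F \<le> ell2_norm h + ell2_norm k" if "finite F" for F
  proof -
    have "L2_set (\<lambda>v. cmod (h v + k v)) F \<le> L2_set (\<lambda>v. cmod (h v) + cmod (k v)) F"
      by (rule L2_set_mono) (auto intro: norm_triangle_ineq)
    also have "\<dots> \<le> L2_set (\<lambda>v. cmod (h v)) F + L2_set (\<lambda>v. cmod (k v)) F"
      by (rule L2_set_triangle_ineq)
    also have "\<dots> \<le> ell2_norm h + ell2_norm k"
      using assms that by (intro add_mono L2_set_le_ell2_norm) auto
    finally show ?thesis .
  qed
  moreover have "h v + k v = 0" if "v \<notin> V" for v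
    using assms that by (simp add: ell2_def)
  ultimately show "(\<lambda>v. h v + k v) \<in> ell2 V"
      "ell2_norm (\<lambda>v. h v + k v) \<le> ell2_norm h + ell2_norm k"
    by (blast intro: ell2_bound)+
qed

lemma ell2_uminus: "h \<in> ell2 V \<Longrightarrow> (\<lambda>v. - h v) \<in> ell2 V"
  by (simp add: ell2_def)

lemma ell2_diff: "h \<in> ell2 V \<Longrightarrow> k \<in> ell2 V \<Longrightarrow> (\<lambda>v. h v - k v) \<in> ell2 V"
  using ell2_triangle(1)[OF _ ell2_uminus, of h V k] by simp

lemma Metric_space_ell2: "Metric_space (ell2 V) ell2_dist"
proof
  fix h k l :: "'a \<Rightarrow> complex"
  show "0 \<le> ell2_dist h k"
    by (simp add: ell2_dist_def ell2_norm_nonneg)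
  show "ell2_dist h k = ell2_dist k h"
    by (simp add: ell2_dist_def ell2_norm_def norm_minus_commute)
  assume h: "h \<in> ell2 V" and k: "k \<in> ell2 V"
  show "ell2_dist h k = 0 \<longleftrightarrow> h = k"
  proof
    assume 0: "ell2_dist h k = 0"
    have "cmod (h v - k v) \<le> 0" for v
      using L2_set_le_ell2_norm[OF ell2_diff[OF h k], of "{v}"] 0
      by (simp add: ell2_dist_def)
    then show "h = k" by auto
  qed (simp add: ell2_dist_def ell2_norm_def)
  assume l: "l \<in> ell2 V"
  show "ell2_dist h l \<le> ell2_dist h k + ell2_dist k l"
    using ell2_triangle(2)[OF ell2_diff[OF h k] ell2_diff[OF k l]] by (simp add: ell2_dist_def)
qed


section \<open>Unbounded operators, spectrum and compact resolvent\<close>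

text \<open>The values of \<open>op_fun\<close> outside \<open>op_dom\<close> are irrelevant.\<close>

record 'a operator =
  op_dom :: "('a \<Rightarrow> complex) set"
  op_fun :: "('a \<Rightarrow> complex) \<Rightarrow> ('a \<Rightarrow> complex)"

definition densely_defined :: "'a set \<Rightarrow> 'a operator \<Rightarrow> bool" where
  "densely_defined V T \<longleftrightarrow>
     op_dom T \<subseteq> ell2 V \<and> ell2_topology V closure_of op_dom T = ell2 V"

definition op_shift :: "'a operator \<Rightarrow> complex \<Rightarrow> ('a \<Rightarrow> complex) \<Rightarrow> ('a \<Rightarrow> complex)" where
  "op_shift T z h = (\<lambda>v. op_fun T h v - z * h v)"

definition resolvent :: "'a operator \<Rightarrow> complex \<Rightarrow> ('a \<Rightarrow> complex) \<Rightarrow> ('a \<Rightarrow> complex)" where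
  "resolvent T z = inv_into (op_dom T) (op_shift T z)"

definition resolvent_set :: "'a set \<Rightarrow> 'a operator \<Rightarrow> complex set" where
  "resolvent_set V T =
     {z. bij_betw (op_shift T z) (op_dom T) (ell2 V) \<and>
         (\<exists>C. \<forall>h\<in>ell2 V. ell2_norm (resolvent T z h) \<le> C * ell2_norm h)}"

definition spectrum :: "'a set \<Rightarrow> 'a operator \<Rightarrow> complex set" where
  "spectrum V T = - resolvent_set V T"

definition compact_operator ::
  "'a set \<Rightarrow> (('a \<Rightarrow> complex) \<Rightarrow> ('a \<Rightarrow> complex)) \<Rightarrow> bool" where
  "compact_operator V K \<longleftrightarrow>
     K ` ell2 V \<subseteq> ell2 V \<and>
     (\<forall>h\<in>ell2 V. \<forall>k\<in>ell2 V. \<forall>c. K (\<lambda>v. c * h v + k v) = (\<lambda>v. c * K h v + K k v)) \<and>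
     compactin (ell2_topology V)
       (ell2_topology V closure_of (K ` {h \<in> ell2 V. ell2_norm h \<le> 1}))"

definition admits_compact_resolvent :: "'a set \<Rightarrow> 'a operator \<Rightarrow> bool" where
  "admits_compact_resolvent V T \<longleftrightarrow>
     densely_defined V T \<and> (\<exists>z. z \<notin> spectrum V T \<and> compact_operator V (resolvent T z))"


section \<open>Rank one extensions of weighted join operators\<close>

definition U_set :: "('a \<times> 'a) set \<Rightarrow> 'a \<Rightarrow> 'a \<Rightarrow> 'a set" where
  "U_set E u b =
     (if b \<in> Des E u then Asc E u \<union> (Des E u - path_verts E u b) else Des E u - {u})"

definition A_set :: "('a \<times> 'a) set \<Rightarrow> 'a \<Rightarrow> 'a \<Rightarrow> 'a set" where
  "A_set E u b = (if b \<in> Des E u then path_verts E u b else Asc E u \<union> {b, u})"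

definition diag_op :: "'a set \<Rightarrow> ('a \<Rightarrow> complex) \<Rightarrow> 'a operator" where
  "diag_op U lam =
     \<lparr>op_dom = {h \<in> ell2 U. (\<lambda>v. lam v * h v) \<in> ell2 U},
      op_fun = (\<lambda>h v. lam v * h v)\<rparr>"

text \<open>The vector \<open>\<Sum>v\<in>A. cnj (lam v) e\<^sub>v\<close>, written out by its coordinates.\<close>

definition weight_vec :: "('a \<Rightarrow> complex) \<Rightarrow> 'a set \<Rightarrow> 'a \<Rightarrow> complex" where
  "weight_vec lam A = (\<lambda>v. if v \<in> A then cnj (lam v) else 0)"

definition N_op ::
  "('a \<times> 'a) set \<Rightarrow> 'a \<Rightarrow> 'a \<Rightarrow> ('a \<Rightarrow> complex) \<Rightarrow> ('a \<Rightarrow> complex) \<Rightarrow> ('a \<Rightarrow> complex)" where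
  "N_op E u b lam = basis_vec u \<otimes>\<^sub>1 weight_vec lam (A_set E u b)"

text \<open>The operator \<open>f \<oslash> g\<close>; here \<open>g\<close> is an arbitrary function on \<open>U\<close> and need not be square
  summable. Convergence of a family indexed by \<open>U\<close> is unconditional convergence.\<close>

definition oslash_op :: "'a set \<Rightarrow> ('a \<Rightarrow> complex) \<Rightarrow> ('a \<Rightarrow> complex) \<Rightarrow> 'a operator" where
  "oslash_op U f g =
     \<lparr>op_dom = {h \<in> ell2 U. (\<lambda>v. h v * cnj (g v)) summable_on U},
      op_fun = (\<lambda>h v. (\<Sum>\<^sub>\<infinity>w\<in>U. h w * cnj (g w)) * f v)\<rparr>"

definition restr :: "'a set \<Rightarrow> ('a \<Rightarrow> complex) \<Rightarrow> 'a \<Rightarrow> complex" where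
  "restr U x = (\<lambda>v. if v \<in> U then x v else 0)"

text \<open>
  The pair \<open>(h, k)\<close> with \<open>h \<in> \<ell>\<^sup>2(U)\<close> and \<open>k \<in> \<ell>\<^sup>2(V) \<ominus> \<ell>\<^sup>2(U)\<close> is identified with \<open>x = h + k\<close>, so that
  \<open>h = restr U x\<close> and \<open>k = restr (- U) x\<close>. The block matrix sends it to the sum of \<open>D h\<close> (in \<open>\<ell>\<^sup>2(U)\<close>)
  and \<open>(f \<oslash> g) h + N k\<close> (in \<open>\<ell>\<^sup>2(V) \<ominus> \<ell>\<^sup>2(U)\<close>).
\<close>

definition W_op ::
  "'a set \<Rightarrow> ('a \<times> 'a) set \<Rightarrow> 'a \<Rightarrow> 'a \<Rightarrow> ('a \<Rightarrow> complex) \<Rightarrow>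
   ('a \<Rightarrow> complex) \<Rightarrow> ('a \<Rightarrow> complex) \<Rightarrow> 'a operator" where
  "W_op V E u b lam f g =
     (let U = U_set E u b; D = diag_op U lam; R = oslash_op U f g; N = N_op E u b lam in
      \<lparr>op_dom = {\<lambda>v. h v + k v | h k. h \<in> op_dom D \<inter> op_dom R \<and> k \<in> ell2 V \<ominus> ell2 U},
       op_fun = (\<lambda>x v. op_fun D (restr U x) v +
                       (op_fun R (restr U x) v + N (restr (- U) x) v))\<rparr>)"

definition compatibility_I ::
  "'a set \<Rightarrow> ('a \<Rightarrow> complex) \<Rightarrow> ('a \<Rightarrow> complex) \<Rightarrow> bool" where
  "compatibility_I U lam g \<longleftrightarrow>
     (\<exists>\<mu>\<^sub>0. (INF v\<in>U. cmod (\<mu>\<^sub>0 - lam v)) > 0 \<and>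
           (\<lambda>v. (cmod (g v))\<^sup>2 / (cmod (lam v - \<mu>\<^sub>0))\<^sup>2) summable_on U)"

end

theory Submission
  imports Defs
begin

text \<open>
  Write \<open>\<ell>\<^sup>2(V) = \<ell>\<^sup>2(U) \<oplus> \<ell>\<^sup>2(V - U)\<close>. The operator \<open>W - z\<close> is lower triangular, with the diagonal entries
  \<open>D - z\<close> and \<open>N - z\<close>, where \<open>D\<close> is diagonal and \<open>N\<close> has rank at most one. This leads to
  \<open>compact_resolvent_iff\<close>: the resolvent is compact for some \<open>z\<close> if and only if \<open>V - U\<close> is finite and every
  disc contains \<open>lam v\<close> for only finitely many \<open>v \<in> U\<close>.

  If the resolvent at \<open>z\<close> is compact, it cannot map infinitely many unit vectors to uniformly
  separated ones (\<open>compact_operator_separated_finite\<close>). On the unit vectors outside \<open>U\<close> and the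
  finite set \<open>A\<close> that supports \<open>N\<close>, it acts as multiplication by \<open>- 1 / z\<close>, so \<open>V - U\<close> is finite. On \<open>e\<^sub>v\<close> with
  \<open>v \<in> U\<close> its component in \<open>\<ell>\<^sup>2(U)\<close> is \<open>e\<^sub>v / (lam v - z)\<close>, so only finitely many weights lie in a disc.

  Conversely, the system \<open>(W - z) x = y\<close> is solved explicitly. The solution depends on \<open>y\<close> through
  the diagonal operator with weights \<open>1 / (lam v - z)\<close>, which tend to zero, and through finitely many
  linear functionals. These are bounded by the Cauchy--Schwarz inequality because the
  compatibility condition makes \<open>g v / (lam v - z)\<close> square summable for \<open>z\<close> near \<open>\<mu>\<^sub>0\<close>. Such an operator
  is compact (\<open>diag_plus_functionals_compact\<close>), since the image of the unit ball is bounded with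
  uniformly small tails.

  It remains to read the finiteness of \<open>V - U\<close> off the tree (\<open>finite_complement_U_set_iff\<close>): the vertices
  outside \<open>U\<close> are a finite set together with all vertices that are not comparable to \<open>u\<close>. The latter lie behind the branchings at ascendants of \<open>u\<close>, and each such branching has infinitely
  many of them behind it because the tree is leafless.
\<close>


section \<open>Descendants and ascendants in a rooted directed tree\<close>

lemma Asc_eq_trancl: "Asc E u = {w. (w, u) \<in> E\<^sup>+}"
  by (auto simp: Asc_def trancl_power Suc_le_eq)

context directed_tree
begin

lemma parent_eq: "(w, v) \<in> E \<Longrightarrow> (w', v) \<in> E \<Longrightarrow> w = w'"
  using unique_parent edges by blast

lemma ancestors_comparable:
  assumes "(x, y) \<in> E\<^sup>*" "(x', y) \<in> E\<^sup>*"
  shows "(x, x') \<in> E\<^sup>* \<or> (x', x) \<in> E\<^sup>*"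
  using assms
proof (induction arbitrary: x' rule: rtrancl_induct)
  case (step y z)
  from step.prems show ?case
  proof (cases rule: rtranclE)
    case base
    then show ?thesis using step.hyps by auto
  next
    case (step y')
    then show ?thesis using step.IH parent_eq \<open>(y, z) \<in> E\<close> by blast
  qed
qed auto

lemma sibling_not_ancestor:
  assumes "(x, w) \<in> E" "(x, w') \<in> E" "w \<noteq> w'"
  shows "(w, w') \<notin> E\<^sup>*"
proof
  assume "(w, w') \<in> E\<^sup>*"
  then obtain p where "(w, p) \<in> E\<^sup>*" "(p, w') \<in> E"
    using assms(3) by (auto elim: rtranclE)
  then have "(x, x) \<in> E\<^sup>+"
    using parent_eq[OF assms(2)] assms(1) by auto
  then show False
    using no_circuits by (auto simp: acyclic_def)
qed

text \<open>A common descendant would make the siblings comparable, and the path from one to the other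
  would enter the latter through the common parent \<open>x\<close> and close a circuit.\<close>

lemma siblings_disjoint_Des:
  assumes "(x, w) \<in> E" "(x, w') \<in> E" "w \<noteq> w'"
  shows "Des E w \<inter> Des E w' = {}"
  using ancestors_comparable sibling_not_ancestor assms
  unfolding Des_def by blast

lemma Des_subset: "v \<in> V \<Longrightarrow> Des E v \<subseteq> V"
  using edges by (auto simp: Des_def elim: rtranclE)

lemma Asc_subset: "Asc E v \<subseteq> V"
  using edges by (auto simp: Asc_eq_trancl dest: tranclD)

lemma not_Asc_and_Des:
  assumes "w \<in> Asc E v"
  shows "w \<notin> Des E v"
proof
  assume "w \<in> Des E v"
  then have "(v, v) \<in> E\<^sup>+"
    using assms by (auto simp: Asc_eq_trancl Des_def)
  then show False
    using no_circuits by (auto simp: acyclic_def)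
qed

text \<open>A finite set of descendants would contain a vertex that is maximal for the acyclic
  relation \<open>E\<close>, and such a vertex is a leaf.\<close>

lemma infinite_Des:
  assumes "leafless V E" "v \<in> V"
  shows "infinite (Des E v)"
proof
  assume fin: "finite (Des E v)"
  let ?R = "E \<inter> Des E v \<times> Des E v"
  have "wf (?R\<inverse>)"
    using fin no_circuits by (intro finite_acyclic_wf_converse) (auto intro: acyclic_subset)
  moreover have "v \<in> Des E v"
    by (simp add: Des_def)
  ultimately obtain m where m: "m \<in> Des E v" "\<And>y. (y, m) \<in> ?R\<inverse> \<Longrightarrow> y \<notin> Des E v"
    by (rule wfE_min) blast
  obtain y where "(m, y) \<in> E"
    using assms(1) m(1) Des_subset[OF assms(2)] unfolding leafless_def by blast
  with m show False
    by (auto simp: Des_def intro: rtrancl_into_rtrancl)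
qed

end

context rooted_directed_tree
begin

text \<open>An undirected path can be followed from the root by directed paths: a step against an edge
  leads to the unique parent of the current vertex, through which its path from the root passes.\<close>

lemma obtain_root:
  obtains r where "r \<in> V" "\<And>v. v \<in> V \<Longrightarrow> (r, v) \<in> E\<^sup>*"
proof -
  obtain r where r: "r \<in> V" "\<And>w. (w, r) \<notin> E"
    using unique_root by blast
  have "(r, v) \<in> E\<^sup>*" if "v \<in> V" for v
    using connected[OF r(1) that]
  proof (induction rule: rtrancl_induct)
    case (step y z)
    from step.hyps(2) show ?case
    proof
      assume "(y, z) \<in> E"
      then show ?thesis using step.IH by auto
    next
      assume "(y, z) \<in> E\<inverse>"
      then have "(z, y) \<in> E" by simp
      then obtain p where "(r, p) \<in> E\<^sup>*" "(p, y) \<in> E"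
        using step.IH r(2) by (auto elim: rtranclE)
      then show ?thesis
        using parent_eq \<open>(z, y) \<in> E\<close> by blast
    qed
  qed auto
  with r(1) that show ?thesis by blast
qed

text \<open>The ancestors of a vertex form the path from the root, which has only finitely many steps.\<close>

lemma finite_ancestors:
  assumes "v \<in> V"
  shows "finite {w. (w, v) \<in> E\<^sup>*}"
proof -
  obtain r where r: "r \<in> V" "\<And>v. v \<in> V \<Longrightarrow> (r, v) \<in> E\<^sup>*"
    using obtain_root by blast
  have "(w, r) \<in> E\<^sup>* \<Longrightarrow> w = r" for w
  proof -
    assume "(w, r) \<in> E\<^sup>*"
    then consider "w = r" | "(w, r) \<in> E\<^sup>+"
      by (auto simp: rtrancl_eq_or_trancl)
    then show "w = r"
    proof cases
      case 2
      then have "w \<in> V" using Asc_subset by (auto simp: Asc_eq_trancl)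
      then have "(r, r) \<in> E\<^sup>+" using r(2) 2 by (auto intro: rtrancl_trancl_trancl)
      then show ?thesis using no_circuits by (auto simp: acyclic_def)
    qed
  qed
  then have base: "finite {w. (w, r) \<in> E\<^sup>*}"
    by (auto intro: finite_subset[of _ "{r}"])
  from r(2)[OF assms] show ?thesis
  proof (induction rule: rtrancl_induct)
    case (step y z)
    have "{w. (w, z) \<in> E\<^sup>*} \<subseteq> insert z {w. (w, y) \<in> E\<^sup>*}"
      using parent_eq[OF step.hyps(2)] by (blast elim: rtranclE)
    then show ?case
      using step.IH by (auto intro: finite_subset)
  qed (rule base)
qed

text \<open>Along the path from the root to \<open>v\<close>, the path to \<open>u\<close> can only be left at a branching ascendant of
  \<open>u\<close> or at \<open>u\<close> itself.\<close>

lemma comparable_if_no_branching_ascendant: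
  assumes "branching V E \<inter> Asc E u = {}" "u \<in> V" "v \<in> V"
  shows "(v, u) \<in> E\<^sup>* \<or> (u, v) \<in> E\<^sup>*"
proof -
  obtain r where r: "r \<in> V" "\<And>v. v \<in> V \<Longrightarrow> (r, v) \<in> E\<^sup>*"
    using obtain_root by blast
  from r(2)[OF assms(3)] show ?thesis
  proof (induction rule: rtrancl_induct)
    case base
    then show ?case using r(2)[OF assms(2)] by blast
  next
    case (step y z)
    show ?case
    proof (cases "(u, y) \<in> E\<^sup>*")
      case True
      then show ?thesis using step.hyps(2) by (blast intro: rtrancl_into_rtrancl)
    next
      case False
      then obtain w where w: "(y, w) \<in> E" "(w, u) \<in> E\<^sup>*"
        using step.IH by (metis converse_rtranclE rtrancl.rtrancl_refl)
      then have "y \<notin> branching V E"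
        using assms(1) by (auto simp: Asc_eq_trancl)
      then have "w = z"
        using w(1) step.hyps(2) edges by (auto simp: branching_def)
      then show ?thesis using w(2) by blast
    qed
  qed
qed

lemma finite_Asc: "u \<in> V \<Longrightarrow> finite (Asc E u)"
  by (rule finite_subset[OF _ finite_ancestors]) (auto simp: Asc_eq_trancl)

lemma finite_path_verts: "v \<in> V \<Longrightarrow> finite (path_verts E u v)"
  by (rule finite_subset[OF _ finite_ancestors]) (auto simp: path_verts_def)

lemma U_set_subset: "u \<in> V \<Longrightarrow> U_set E u b \<subseteq> V"
  using Des_subset[of u] Asc_subset[of u] by (auto simp: U_set_def)

lemma finite_A_set: "u \<in> V \<Longrightarrow> b \<in> V \<Longrightarrow> finite (A_set E u b)"
  by (simp add: A_set_def finite_Asc finite_path_verts)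

lemma A_set_subset: "u \<in> V \<Longrightarrow> b \<in> V \<Longrightarrow> A_set E u b \<subseteq> V - U_set E u b"
  using Asc_subset[of u] Des_subset[of u] not_Asc_and_Des[of _ u]
  by (auto simp: A_set_def U_set_def path_verts_def Des_def split: if_splits)

lemma u_in_A_set: "u \<in> A_set E u b"
  by (auto simp: A_set_def path_verts_def Des_def)

text \<open>If \<open>x\<close> is an ascendant of \<open>u\<close> with a child \<open>w'\<close> off the path to \<open>u\<close>, then the infinite set
  \<open>Des E w'\<close> lies outside \<open>U\<close>. Without such \<open>x\<close> every vertex is comparable to \<open>u\<close>, and all that is
  left outside \<open>U\<close> is a path ending in \<open>u\<close> or in \<open>b\<close>.\<close>

lemma finite_complement_U_set_iff:
  assumes "leafless V E" "u \<in> V" "b \<in> V"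
  shows "finite (V - U_set E u b) \<longleftrightarrow> branching V E \<inter> Asc E u = {}"
proof
  assume fin: "finite (V - U_set E u b)"
  show "branching V E \<inter> Asc E u = {}"
  proof (rule ccontr)
    assume "\<not> ?thesis"
    then obtain x p q where x: "(x, u) \<in> E\<^sup>+" "(x, p) \<in> E" "(x, q) \<in> E" "p \<noteq> q"
      by (auto simp: branching_def Asc_eq_trancl)
    obtain w where w: "(x, w) \<in> E" "(w, u) \<in> E\<^sup>*"
      using x(1) by (auto dest: tranclD)
    obtain w' where w': "(x, w') \<in> E" "w' \<noteq> w"
      using x by blast
    have disj: "Des E w \<inter> Des E w' = {}"
      using siblings_disjoint_Des[OF w(1) w'(1)] w'(2) by blast
    have "Des E w' \<inter> U_set E u b = {}"
    proof -
      have "y \<notin> Des E u" if "y \<in> Des E w'" for y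
        using that disj w(2) unfolding Des_def by (blast intro: rtrancl_trans)
      moreover have "y \<notin> Asc E u" if "y \<in> Des E w'" for y
        using that disj w(2) unfolding Des_def Asc_eq_trancl
          by (blast intro: rtrancl_trans trancl_into_rtrancl)
      ultimately show ?thesis
        by (auto simp: U_set_def)
    qed
    moreover have "w' \<in> V"
      using w'(1) edges by auto
    ultimately have "Des E w' \<subseteq> V - U_set E u b"
      using Des_subset by blast
    then show False
      using fin infinite_Des[OF assms(1) \<open>w' \<in> V\<close>] finite_subset by blast
  qed
next
  assume "branching V E \<inter> Asc E u = {}"
  then have "V - U_set E u b \<subseteq> {w. (w, u) \<in> E\<^sup>*} \<union> path_verts E u b"
    using comparable_if_no_branching_ascendant assms(2)
    by (auto simp: U_set_def Des_def)
  then show "finite (V - U_set E u b)"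
    using finite_ancestors[OF assms(2)] finite_path_verts[OF assms(3)] finite_subset by blast
qed

end


section \<open>The metric space \<open>\<ell>\<^sup>2(V)\<close>\<close>

lemma cmod_le_ell2_norm: "h \<in> ell2 V \<Longrightarrow> cmod (h v) \<le> ell2_norm h"
  using L2_set_le_ell2_norm[of h V "{v}"] by simp

lemma ell2_dominated:
  assumes "k \<in> ell2 W" "0 \<le> B" "\<And>v. v \<notin> V \<Longrightarrow> h v = 0" "\<And>v. cmod (h v) \<le> B * cmod (k v)"
  shows "h \<in> ell2 V" "ell2_norm h \<le> B * ell2_norm k"
proof -
  have "L2_set (\<lambda>v. cmod (h v)) F \<le> B * ell2_norm k" if "finite F" for F
  proof -
    have "L2_set (\<lambda>v. cmod (h v)) F \<le> L2_set (\<lambda>v. B * cmod (k v)) F"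
      using assms by (intro L2_set_mono) auto
    also have "\<dots> = B * L2_set (\<lambda>v. cmod (k v)) F"
      using assms(2) by (simp add: L2_set_right_distrib)
    also have "\<dots> \<le> B * ell2_norm k"
      using assms(1,2) that by (intro mult_left_mono L2_set_le_ell2_norm)
    finally show ?thesis .
  qed
  from ell2_bound[OF assms(3) this] show "h \<in> ell2 V" "ell2_norm h \<le> B * ell2_norm k"
    by auto
qed

lemma ell2_finite_support:
  assumes "finite F" "F \<subseteq> V" "\<And>v. v \<notin> F \<Longrightarrow> h v = 0"
  shows "h \<in> ell2 V" "ell2_norm h \<le> (\<Sum>v\<in>F. cmod (h v))"
proof -
  have "L2_set (\<lambda>v. cmod (h v)) G \<le> (\<Sum>v\<in>F. cmod (h v))" if "finite G" for G
  proof -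
    have "L2_set (\<lambda>v. cmod (h v)) G \<le> (\<Sum>v\<in>G. cmod (h v))"
      by (intro L2_set_le_sum) auto
    also have "\<dots> = (\<Sum>v\<in>G \<inter> F. cmod (h v))"
      using that assms(3) by (intro sum.mono_neutral_right) auto
    also have "\<dots> \<le> (\<Sum>v\<in>F. cmod (h v))"
      using assms(1) by (intro sum_mono2) auto
    finally show ?thesis .
  qed
  from ell2_bound[OF _ this, of V] show "h \<in> ell2 V" "ell2_norm h \<le> (\<Sum>v\<in>F. cmod (h v))"
    using assms(2,3) by auto
qed

lemma ell2_scale:
  assumes "h \<in> ell2 V"
  shows "(\<lambda>v. c * h v) \<in> ell2 V" "ell2_norm (\<lambda>v. c * h v) \<le> cmod c * ell2_norm h"
  using ell2_dominated[OF assms norm_ge_zero[of c], of V "\<lambda>v. c * h v"] assms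
  by (auto simp: norm_mult ell2_def)

lemma ell2_mono: "V \<subseteq> W \<Longrightarrow> ell2 V \<subseteq> ell2 W"
  by (auto simp: ell2_def)

lemma restr_ell2:
  assumes "h \<in> ell2 V"
  shows "restr S h \<in> ell2 (S \<inter> V)" "restr S h \<in> ell2 V"
  using ell2_dominated[of h V 1 "S \<inter> V" "restr S h"] ell2_dominated[of h V 1 V "restr S h"] assms
  by (auto simp: restr_def ell2_def)

lemma ell2_small_tail:
  assumes "h \<in> ell2 V" "0 < \<epsilon>"
  obtains F where "finite F" "ell2_norm (restr (- F) h) < \<epsilon>"
proof -
  let ?S = "\<Sum>\<^sub>\<infinity>v. (cmod (h v))\<^sup>2"
  have summ: "(\<lambda>v. (cmod (h v))\<^sup>2) summable_on UNIV"
    using assms(1) by (simp add: ell2_def)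
  then have "((\<lambda>v. (cmod (h v))\<^sup>2) has_sum ?S) UNIV"
    by (rule has_sum_infsum)
  from has_sum_finite_approximation[OF this, of "(\<epsilon> / 2)\<^sup>2"] assms(2)
  obtain F where F: "finite F" "dist (\<Sum>v\<in>F. (cmod (h v))\<^sup>2) ?S \<le> (\<epsilon> / 2)\<^sup>2"
    by auto
  have "L2_set (\<lambda>v. cmod (restr (- F) h v)) G \<le> \<epsilon> / 2" if "finite G" for G
  proof -
    have "(\<Sum>v\<in>G. (cmod (restr (- F) h v))\<^sup>2) = (\<Sum>v\<in>G - F. (cmod (h v))\<^sup>2)"
      using that by (intro sum.mono_neutral_cong_right) (auto simp: restr_def)
    also have "\<dots> = (\<Sum>v\<in>G \<union> F. (cmod (h v))\<^sup>2) - (\<Sum>v\<in>F. (cmod (h v))\<^sup>2)"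
      using that F(1) sum.subset_diff[of F "G \<union> F" "\<lambda>v. (cmod (h v))\<^sup>2"]
      by (simp add: Un_Diff)
    also have "(\<Sum>v\<in>G \<union> F. (cmod (h v))\<^sup>2) \<le> ?S"
      using that F(1) summ by (intro finite_sum_le_infsum) auto
    also have "?S - (\<Sum>v\<in>F. (cmod (h v))\<^sup>2) \<le> (\<epsilon> / 2)\<^sup>2"
      using F(2) by (simp add: dist_real_def)
    finally show ?thesis
      unfolding L2_set_def using assms(2) by (intro real_le_lsqrt) (auto intro: sum_nonneg)
  qed
  then have "ell2_norm (restr (- F) h) \<le> \<epsilon> / 2"
    by (intro ell2_bound(2)[of UNIV]) auto
  with that[OF F(1)] assms(2) show ?thesis by simp
qed

lemma infsum_eq_sum_if_supported:
  fixes h :: "'a \<Rightarrow> complex"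
  assumes "finite F" "\<And>v. v \<notin> F \<Longrightarrow> h v = 0"
  shows "(\<Sum>\<^sub>\<infinity>v. h v) = sum h F"
proof -
  have "(\<Sum>\<^sub>\<infinity>v. h v) = infsum h F"
    using assms by (intro infsum_cong_neutral) auto
  then show ?thesis using assms(1) by simp
qed

lemma ell2_ominus:
  assumes "U \<subseteq> V"
  shows "ell2 V \<ominus> ell2 U = ell2 (V - U)"
proof (intro equalityI subsetI)
  fix h assume h: "h \<in> ell2 V \<ominus> ell2 U"
  have "h v = 0" if "v \<in> U" for v
  proof -
    have "basis_vec v \<in> ell2 U"
      using that by (intro ell2_finite_support[of "{v}"]) (auto simp: basis_vec_def)
    then have "ell2_inner h (basis_vec v) = 0"
      using h by (simp add: ominus_def)
    moreover have "ell2_inner h (basis_vec v) = h v"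
      unfolding ell2_inner_def
      by (subst infsum_eq_sum_if_supported[of "{v}"]) (auto simp: basis_vec_def)
    ultimately show ?thesis by simp
  qed
  with h show "h \<in> ell2 (V - U)"
    by (auto simp: ominus_def ell2_def)
next
  fix h assume h: "h \<in> ell2 (V - U)"
  have "h v * cnj (k v) = 0" if "k \<in> ell2 U" for k v
    using h that by (cases "v \<in> U") (auto simp: ell2_def)
  then have "ell2_inner h k = 0" if "k \<in> ell2 U" for k
    unfolding ell2_inner_def using that by (simp only: infsum_0)
  with h show "h \<in> ell2 V \<ominus> ell2 U"
    using ell2_mono[of "V - U" V] by (auto simp: ominus_def)
qed

lemma ell2_Cauchy_Schwarz:
  assumes "h \<in> ell2 V" "q \<in> ell2 W"
  shows "(\<lambda>v. h v * cnj (q v)) summable_on UNIV"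
    and "cmod (ell2_inner h q) \<le> ell2_norm h * ell2_norm q"
proof -
  have fin: "(\<Sum>v\<in>F. cmod (h v * cnj (q v))) \<le> ell2_norm h * ell2_norm q" if "finite F" for F
  proof -
    have "(\<Sum>v\<in>F. cmod (h v * cnj (q v))) \<le> L2_set (\<lambda>v. cmod (h v)) F * L2_set (\<lambda>v. cmod (q v)) F"
      using L2_set_mult_ineq[of "\<lambda>v. cmod (h v)" "\<lambda>v. cmod (q v)" F] by (simp add: norm_mult)
    also have "\<dots> \<le> ell2_norm h * ell2_norm q"
      using assms that by (intro mult_mono L2_set_le_ell2_norm ell2_norm_nonneg) auto
    finally show ?thesis .
  qed
  have abs: "(\<lambda>v. cmod (h v * cnj (q v))) summable_on UNIV"
    by (rule nonneg_bdd_above_summable_on) (use fin in \<open>auto intro!: bdd_aboveI2\<close>)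
  then show "(\<lambda>v. h v * cnj (q v)) summable_on UNIV"
    by (rule abs_summable_summable)
  have "cmod (ell2_inner h q) \<le> (\<Sum>\<^sub>\<infinity>v. cmod (h v * cnj (q v)))"
    unfolding ell2_inner_def using abs by (rule norm_infsum_bound)
  also have "\<dots> \<le> ell2_norm h * ell2_norm q"
    using abs fin by (intro infsum_le_finite_sums) auto
  finally show "cmod (ell2_inner h q) \<le> ell2_norm h * ell2_norm q" .
qed

text \<open>Completeness is what turns totally bounded sets into sets with compact closure.\<close>

lemma ell2_complete: "Metric_space.mcomplete (ell2 V) ell2_dist"
proof -
  interpret Metric_space "ell2 V" ell2_dist by (rule Metric_space_ell2)
  show ?thesis
    unfolding mcomplete_def
  proof (intro allI impI)
    fix \<sigma> :: "nat \<Rightarrow> 'a \<Rightarrow> complex"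
    assume "MCauchy \<sigma>"
    then have \<sigma>: "\<sigma> n \<in> ell2 V" 
      and cau: "\<And>\<epsilon>. 0 < \<epsilon> \<Longrightarrow> \<exists>N. \<forall>m n. N \<le> m \<longrightarrow> N \<le> n \<longrightarrow> ell2_dist (\<sigma> m) (\<sigma> n) < \<epsilon>" for n
      by (auto simp: MCauchy_def)
    have diff: "(\<lambda>v. \<sigma> m v - \<sigma> n v) \<in> ell2 V" for m n
      by (rule ell2_diff[OF \<sigma> \<sigma>])
    have "Cauchy (\<lambda>n. \<sigma> n v)" for v
    proof (rule metric_CauchyI)
      fix \<epsilon> :: real assume "0 < \<epsilon>"
      with cau obtain N where "\<forall>m n. N \<le> m \<longrightarrow> N \<le> n \<longrightarrow> ell2_dist (\<sigma> m) (\<sigma> n) < \<epsilon>"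
        by blast
      then show "\<exists>N. \<forall>m\<ge>N. \<forall>n\<ge>N. dist (\<sigma> m v) (\<sigma> n v) < \<epsilon>"
        using order.strict_trans1[OF cmod_le_ell2_norm[OF diff]]
        unfolding dist_norm ell2_dist_def by blast
    qed
    then have "\<exists>l. (\<lambda>n. \<sigma> n v) \<longlonglongrightarrow> l" for v
      by (simp add: Cauchy_convergent_iff convergent_def)
    then obtain x where x: "\<And>v. (\<lambda>n. \<sigma> n v) \<longlonglongrightarrow> x v"
      by metis
    have x0: "x v = 0" if "v \<notin> V" for v
    proof -
      have "(\<lambda>n. \<sigma> n v) = (\<lambda>n. 0)"
        using \<sigma> that by (auto simp: ell2_def)
      with x[of v] show ?thesis by (simp add: LIMSEQ_const_iff)
    qed
    \<comment> \<open>Letting \<open>n\<close> tend to infinity in a Cauchy estimate over a fixed finite set\<close>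
    have lim: "(\<lambda>v. \<sigma> m v - x v) \<in> ell2 V \<and> ell2_norm (\<lambda>v. \<sigma> m v - x v) \<le> \<epsilon>"
      if N: "\<forall>m n. N \<le> m \<longrightarrow> N \<le> n \<longrightarrow> ell2_dist (\<sigma> m) (\<sigma> n) < \<epsilon>" and "N \<le> m" for N m \<epsilon>
    proof -
      have "L2_set (\<lambda>v. cmod (\<sigma> m v - x v)) F \<le> \<epsilon>" if "finite F" for F
      proof (rule tendsto_upperbound)
        show "(\<lambda>n. L2_set (\<lambda>v. cmod (\<sigma> m v - \<sigma> n v)) F) \<longlonglongrightarrow> L2_set (\<lambda>v. cmod (\<sigma> m v - x v)) F"
          unfolding L2_set_def by (intro tendsto_intros x)
        have "L2_set (\<lambda>v. cmod (\<sigma> m v - \<sigma> n v)) F \<le> \<epsilon>" if "N \<le> n" for n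
          using L2_set_le_ell2_norm[OF diff[of m n] \<open>finite F\<close>] N[rule_format, OF \<open>N \<le> m\<close> that]
          by (simp add: ell2_dist_def)
        then show "\<forall>\<^sub>F n in sequentially. L2_set (\<lambda>v. cmod (\<sigma> m v - \<sigma> n v)) F \<le> \<epsilon>"
          by (auto simp: eventually_sequentially)
      qed auto
      moreover have "\<sigma> m v - x v = 0" if "v \<notin> V" for v
        using \<sigma> x0 that by (auto simp: ell2_def)
      ultimately show ?thesis
        using ell2_bound[of V "\<lambda>v. \<sigma> m v - x v" \<epsilon>] by simp
    qed
    obtain N where N: "\<forall>m n. N \<le> m \<longrightarrow> N \<le> n \<longrightarrow> ell2_dist (\<sigma> m) (\<sigma> n) < 1"
      using cau[of 1] by auto
    have "(\<lambda>v. \<sigma> N v - (\<sigma> N v - x v)) \<in> ell2 V"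
      by (rule ell2_diff[OF \<sigma> conjunct1[OF lim[OF N order_refl]]])
    then have xV: "x \<in> ell2 V"
      by simp
    have "\<exists>N. \<forall>n\<ge>N. \<sigma> n \<in> ell2 V \<and> ell2_dist (\<sigma> n) x < \<epsilon>" if \<epsilon>: "0 < \<epsilon>" for \<epsilon>
    proof -
      obtain N where "\<forall>m n. N \<le> m \<longrightarrow> N \<le> n \<longrightarrow> ell2_dist (\<sigma> m) (\<sigma> n) < \<epsilon> / 2"
        using cau[of "\<epsilon> / 2"] \<epsilon> by auto
      from lim[OF this] \<epsilon> show ?thesis
        using \<sigma> by (force simp: ell2_dist_def)
    qed
    with xV show "\<exists>x. limitin mtopology \<sigma> x sequentially"
      by (auto simp: limit_metric_sequentially)
  qed
qed

text \<open>For the finitely many coordinates in \<open>F\<close> the bounded set \<open>S\<close> is replaced, up to a small error,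
  by finitely many points of a disc; the remaining coordinates contribute little. Vectors with the
  same approximating points are therefore close to each other, and one representative of each
  class makes up a finite net.\<close>

lemma totally_bounded_if_small_tails:
  assumes S: "S \<subseteq> ell2 V" and B: "\<And>x v. x \<in> S \<Longrightarrow> cmod (x v) \<le> B"
    and tails: "\<And>\<epsilon>. 0 < \<epsilon> \<Longrightarrow> \<exists>F. finite F \<and> (\<forall>x\<in>S. ell2_norm (restr (- F) x) \<le> \<epsilon>)"
  shows "Metric_space.mtotally_bounded (ell2 V) ell2_dist S"
proof -
  interpret Metric_space "ell2 V" ell2_dist by (rule Metric_space_ell2)
  show ?thesis
    unfolding mtotally_bounded_def
  proof (intro allI impI)
    fix \<epsilon> :: real assume \<epsilon>: "0 < \<epsilon>"
    obtain F where F: "finite F" "\<And>x. x \<in> S \<Longrightarrow> ell2_norm (restr (- F) x) \<le> \<epsilon> / 4"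
      using tails[of "\<epsilon> / 4"] \<epsilon> by auto
    define \<delta> where "\<delta> = \<epsilon> / (8 * (real (card F) + 1))"
    have \<delta>: "0 < \<delta>"
      using \<epsilon> by (simp add: \<delta>_def)
    have small: "real (card F) * (2 * \<delta>) < \<epsilon> / 2"
    proof -
      have "k * (\<epsilon> / (8 * k)) = \<epsilon> / 8" if "0 < k" for k
        using that by simp
      from this[of "real (card F) + 1"] have "(real (card F) + 1) * \<delta> = \<epsilon> / 8"
        unfolding \<delta>_def by simp
      with \<delta> \<epsilon> show ?thesis by (simp add: distrib_right)
    qed
    obtain P where P: "finite P" "cball (0 :: complex) B \<subseteq> (\<Union>p\<in>P. ball p \<delta>)"
      using compact_imp_seq_compact[OF compact_cball[of "0::complex" B], THEN seq_compact_imp_totally_bounded, rule_format, OF \<delta>]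
      by blast
    define code where "code x = (\<lambda>v\<in>F. SOME p. p \<in> P \<and> dist p (x v) < \<delta>)" for x
    have code: "code x v \<in> P \<and> dist (code x v) (x v) < \<delta>" if "x \<in> S" "v \<in> F" for x v
    proof -
      have "x v \<in> cball 0 B"
        using B[OF that(1)] by simp
      then have "x v \<in> (\<Union>p\<in>P. ball p \<delta>)"
        using P(2) by (rule subsetD[rotated])
      then have "\<exists>p. p \<in> P \<and> dist p (x v) < \<delta>"
        by auto
      from someI_ex[OF this] that(2) show ?thesis
        by (simp add: code_def)
    qed
    have "code ` S \<subseteq> F \<rightarrow>\<^sub>E P"
      using code by (auto simp: code_def)
    then have fin_code: "finite (code ` S)"
      by (rule finite_subset) (simp add: finite_PiE F(1) P(1))
    have "ell2_dist x y < \<epsilon>" if x: "x \<in> S" and y: "y \<in> S" and eq: "code x = code y" for x y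
    proof -
      let ?d = "\<lambda>v. x v - y v"
      have "cmod (restr F ?d v) \<le> 2 * \<delta>" if "v \<in> F" for v
      proof -
        have "dist (x v) (y v) < 2 * \<delta>"
          using code[OF x that] code[OF y that] eq
          by (intro dist_triangle_half_r[of "code x v" "x v" "2 * \<delta>" "y v"]) auto
        then show ?thesis
          using that by (simp add: restr_def dist_norm)
      qed
      then have "(\<Sum>v\<in>F. cmod (restr F ?d v)) \<le> real (card F) * (2 * \<delta>)"
        using sum_bounded_above[of F "\<lambda>v. cmod (restr F ?d v)" "2 * \<delta>"] by simp
      moreover have dF: "restr F ?d \<in> ell2 UNIV" "ell2_norm (restr F ?d) \<le> (\<Sum>v\<in>F. cmod (restr F ?d v))"
        using ell2_finite_support[OF F(1), of UNIV "restr F ?d"] by (auto simp: restr_def)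
      moreover have xy: "x \<in> ell2 UNIV" "y \<in> ell2 UNIV"
        using x y S ell2_mono[of V UNIV] by auto
      note xF = restr_ell2(2)[OF xy(1), of "- F"]
        and yF = ell2_scale[OF restr_ell2(2)[OF xy(2), of "- F"], of "- 1"]
      have split: "restr (- F) ?d = (\<lambda>v. restr (- F) x v + (- 1) * restr (- F) y v)"
        by (auto simp: restr_def)
      have dT: "restr (- F) ?d \<in> ell2 UNIV"
        unfolding split using xF yF(1) by (rule ell2_triangle(1))
      have "ell2_norm (restr (- F) ?d) \<le> \<epsilon> / 4 + \<epsilon> / 4"
        using ell2_triangle(2)[OF xF yF(1)] yF(2) F(2)[OF x] F(2)[OF y] unfolding split by simp
      moreover have "(\<lambda>v. restr F ?d v + restr (- F) ?d v) = ?d"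
        by (auto simp: restr_def)
      with ell2_triangle(2)[OF dF(1) dT]
      have "ell2_norm ?d \<le> ell2_norm (restr F ?d) + ell2_norm (restr (- F) ?d)"
        by (simp only:)
      ultimately have "ell2_norm ?d \<le> real (card F) * (2 * \<delta>) + (\<epsilon> / 4 + \<epsilon> / 4)"
        by linarith
      with small show ?thesis
        by (simp add: ell2_dist_def)
    qed
    then have "x \<in> mball (inv_into S code (code x)) \<epsilon>" if "x \<in> S" for x
      using that S by (simp add: in_mball f_inv_into_f inv_into_into subset_iff)
    then have "S \<subseteq> (\<Union>x\<in>inv_into S code ` code ` S. mball x \<epsilon>)"
      by auto
    moreover have "inv_into S code ` code ` S \<subseteq> S"
      by (auto intro: inv_into_into)
    ultimately show "\<exists>K. finite K \<and> K \<subseteq> S \<and> S \<subseteq> (\<Union>x\<in>K. mball x \<epsilon>)"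
      using finite_imageI[OF fin_code, of "inv_into S code"] by metis
  qed
qed


section \<open>Compact operators\<close>

lemma compact_operator_iff_totally_bounded:
  "compact_operator V K \<longleftrightarrow> K ` ell2 V \<subseteq> ell2 V \<and>
     (\<forall>h\<in>ell2 V. \<forall>k\<in>ell2 V. \<forall>c. K (\<lambda>v. c * h v + k v) = (\<lambda>v. c * K h v + K k v)) \<and>
     Metric_space.mtotally_bounded (ell2 V) ell2_dist (K ` {h \<in> ell2 V. ell2_norm h \<le> 1})"
proof -
  have "K ` ell2 V \<subseteq> ell2 V \<Longrightarrow> K ` {h \<in> ell2 V. ell2_norm h \<le> 1} \<subseteq> ell2 V"
    by blast
  then show ?thesis
    unfolding compact_operator_def ell2_topology_def
      Metric_space.mtotally_bounded_eq_compact_closure_of[OF Metric_space_ell2 ell2_complete]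
    by satx
qed

text \<open>The coordinates \<open>i \<in> I\<close> keep the images of the vectors \<open>y i\<close> at distance at least \<open>t\<close> from each
  other, so no finite set can come close to all of them.\<close>

lemma compact_operator_separated_finite:
  assumes K: "compact_operator V K"
    and y: "\<And>i. i \<in> I \<Longrightarrow> y i \<in> ell2 V" "\<And>i. i \<in> I \<Longrightarrow> ell2_norm (y i) \<le> 1"
    and t: "0 < t" "\<And>i j. i \<in> I \<Longrightarrow> j \<in> I \<Longrightarrow> i \<noteq> j \<Longrightarrow> t \<le> cmod (K (y i) i - K (y j) i)"
  shows "finite I"
proof -
  interpret Metric_space "ell2 V" ell2_dist by (rule Metric_space_ell2)
  let ?S = "K ` {h \<in> ell2 V. ell2_norm h \<le> 1}"
  have "mtotally_bounded ?S"
    using K by (simp add: compact_operator_iff_totally_bounded)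
  then obtain P where P: "finite P" "?S \<subseteq> (\<Union>p\<in>P. mball p (t / 2))"
    unfolding mtotally_bounded_def using half_gt_zero[OF t(1)] by blast
  have "\<exists>p\<in>P. K (y i) \<in> mball p (t / 2)" if "i \<in> I" for i
  proof -
    have "K (y i) \<in> ?S"
      using y[OF that] by blast
    with P(2) show ?thesis by blast
  qed
  then obtain p where p: "\<And>i. i \<in> I \<Longrightarrow> p i \<in> P" "\<And>i. i \<in> I \<Longrightarrow> K (y i) \<in> mball (p i) (t / 2)"
    by metis
  have "inj_on p I"
  proof (rule inj_onI, rule ccontr)
    fix i j assume ij: "i \<in> I" "j \<in> I" "p i = p j" "i \<noteq> j"
    have KV: "K (y i) \<in> ell2 V" "K (y j) \<in> ell2 V" "p j \<in> ell2 V"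
      using p(2)[OF ij(1)] p(2)[OF ij(2)] by (auto simp: in_mball)
    have "ell2_dist (K (y i)) (K (y j)) \<le> ell2_dist (K (y i)) (p j) + ell2_dist (p j) (K (y j))"
      using KV by (intro triangle)
    also have "\<dots> < t"
      using p(2)[OF ij(1)] p(2)[OF ij(2)] ij(3) commute[of "K (y i)" "p j"]
      by (simp add: in_mball)
    finally have "ell2_dist (K (y i)) (K (y j)) < t" .
    moreover have "cmod (K (y i) i - K (y j) i) \<le> ell2_dist (K (y i)) (K (y j))"
      using cmod_le_ell2_norm[OF ell2_diff[OF KV(1,2)]] by (simp add: ell2_dist_def)
    ultimately show False
      using t(2)[OF ij(1,2,4)] by linarith
  qed
  moreover have "p ` I \<subseteq> P"
    using p(1) by blast
  ultimately show ?thesis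
    using P(1) by (metis finite_imageD finite_subset)
qed

definition bounded_functional :: "'a set \<Rightarrow> (('a \<Rightarrow> complex) \<Rightarrow> complex) \<Rightarrow> bool" where
  "bounded_functional V \<phi> \<longleftrightarrow>
     (\<forall>h\<in>ell2 V. \<forall>k\<in>ell2 V. \<forall>c. \<phi> (\<lambda>v. c * h v + k v) = c * \<phi> h + \<phi> k) \<and>
     (\<exists>M\<ge>0. \<forall>h\<in>ell2 V. cmod (\<phi> h) \<le> M * ell2_norm h)"

lemma bounded_functional_coord: "bounded_functional V (\<lambda>h. h v)"
  using cmod_le_ell2_norm[of _ V v] by (auto simp: bounded_functional_def intro!: exI[of _ 1])

lemma bounded_functional_add:
  assumes "bounded_functional V \<phi>" "bounded_functional V \<psi>"
  shows "bounded_functional V (\<lambda>h. \<phi> h + \<psi> h)"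
proof -
  obtain M M' where M: "0 \<le> M" "\<And>h. h \<in> ell2 V \<Longrightarrow> cmod (\<phi> h) \<le> M * ell2_norm h"
    "0 \<le> M'" "\<And>h. h \<in> ell2 V \<Longrightarrow> cmod (\<psi> h) \<le> M' * ell2_norm h"
    using assms unfolding bounded_functional_def by blast
  have "cmod (\<phi> h + \<psi> h) \<le> (M + M') * ell2_norm h" if "h \<in> ell2 V" for h
    using M(2)[OF that] M(4)[OF that] norm_triangle_ineq[of "\<phi> h" "\<psi> h"]
    by (simp add: distrib_right)
  moreover have "0 \<le> M + M'"
    using M by simp
  ultimately have "\<exists>M\<ge>0. \<forall>h\<in>ell2 V. cmod (\<phi> h + \<psi> h) \<le> M * ell2_norm h"
    by blast
  then show ?thesis
    using assms unfolding bounded_functional_def by (simp add: algebra_simps)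
qed

lemma bounded_functional_scale:
  assumes "bounded_functional V \<phi>"
  shows "bounded_functional V (\<lambda>h. a * \<phi> h)"
proof -
  obtain M where M: "0 \<le> M" "\<And>h. h \<in> ell2 V \<Longrightarrow> cmod (\<phi> h) \<le> M * ell2_norm h"
    using assms unfolding bounded_functional_def by blast
  have "cmod (a * \<phi> h) \<le> (cmod a * M) * ell2_norm h" if "h \<in> ell2 V" for h
    using mult_left_mono[OF M(2)[OF that] norm_ge_zero[of a]] by (simp add: norm_mult mult.assoc)
  moreover have "0 \<le> cmod a * M"
    using M by simp
  ultimately have "\<exists>M\<ge>0. \<forall>h\<in>ell2 V. cmod (a * \<phi> h) \<le> M * ell2_norm h"
    by blast
  then show ?thesis
    using assms unfolding bounded_functional_def by (simp add: algebra_simps)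
qed

lemma bounded_functional_zero: "bounded_functional V (\<lambda>h. 0)"
  by (auto simp: bounded_functional_def)

lemma bounded_functional_sum:
  assumes "\<And>i. i \<in> F \<Longrightarrow> bounded_functional V (\<phi> i)"
  shows "bounded_functional V (\<lambda>h. \<Sum>i\<in>F. \<phi> i h)"
  using assms
  by (induction F rule: infinite_finite_induct)
    (auto intro: bounded_functional_add bounded_functional_zero)

lemma bounded_functional_inner:
  assumes "q \<in> ell2 W"
  shows "bounded_functional V (\<lambda>h. ell2_inner h q)"
proof -
  have "ell2_inner (\<lambda>v. c * h v + k v) q = c * ell2_inner h q + ell2_inner k q"
    if "h \<in> ell2 V" "k \<in> ell2 V" for h k c
  proof -
    note sh = ell2_Cauchy_Schwarz(1)[OF that(1) assms] and sk = ell2_Cauchy_Schwarz(1)[OF that(2) assms]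
    have "ell2_inner (\<lambda>v. c * h v + k v) q = (\<Sum>\<^sub>\<infinity>v. c * (h v * cnj (q v)) + k v * cnj (q v))"
      by (simp add: ell2_inner_def algebra_simps)
    also have "\<dots> = (\<Sum>\<^sub>\<infinity>v. c * (h v * cnj (q v))) + (\<Sum>\<^sub>\<infinity>v. k v * cnj (q v))"
      using sh sk by (intro infsum_add summable_on_cmult_right)
    also have "\<dots> = c * ell2_inner h q + ell2_inner k q"
      using sh by (simp add: ell2_inner_def infsum_cmult_right)
    finally show ?thesis .
  qed
  moreover have "cmod (ell2_inner h q) \<le> ell2_norm q * ell2_norm h" if "h \<in> ell2 V" for h
    using ell2_Cauchy_Schwarz(2)[OF that assms] by (simp add: mult.commute)
  ultimately show ?thesis
    unfolding bounded_functional_def using ell2_norm_nonneg[of q] by blast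
qed

text \<open>The shape of the resolvent of \<open>W\<^bsub>f,g\<^esub>\<close>: diagonal on \<open>U\<close>, while each of the coordinates in \<open>C\<close> is
  some functional of the whole vector.\<close>

definition diag_plus_functionals ::
  "'a set \<Rightarrow> ('a \<Rightarrow> complex) \<Rightarrow> 'a set \<Rightarrow> ('a \<Rightarrow> ('a \<Rightarrow> complex) \<Rightarrow> complex) \<Rightarrow>
   ('a \<Rightarrow> complex) \<Rightarrow> 'a \<Rightarrow> complex" where
  "diag_plus_functionals U a C \<phi> h = (\<lambda>v. if v \<in> U then a v * h v else if v \<in> C then \<phi> v h else 0)"

lemma diag_plus_functionals_bounded:
  assumes UC: "U \<subseteq> V" "C \<subseteq> V" "finite C" and a: "\<And>v. v \<in> U \<Longrightarrow> cmod (a v) \<le> B"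
    and \<phi>: "\<And>v. v \<in> C \<Longrightarrow> bounded_functional V (\<phi> v)"
  shows "\<exists>M\<ge>0. \<forall>h\<in>ell2 V. diag_plus_functionals U a C \<phi> h \<in> ell2 V \<and>
    ell2_norm (diag_plus_functionals U a C \<phi> h) \<le> M * ell2_norm h"
proof -
  obtain m where m: "\<And>v h. v \<in> C \<Longrightarrow> h \<in> ell2 V \<Longrightarrow> cmod (\<phi> v h) \<le> m v * ell2_norm h"
    "\<And>v. v \<in> C \<Longrightarrow> 0 \<le> m v"
    using \<phi> unfolding bounded_functional_def by metis
  let ?M = "\<bar>B\<bar> + (\<Sum>v\<in>C. m v)"
  have "diag_plus_functionals U a C \<phi> h \<in> ell2 V \<and>
    ell2_norm (diag_plus_functionals U a C \<phi> h) \<le> ?M * ell2_norm h" if h: "h \<in> ell2 V" for h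
  proof -
    let ?d = "\<lambda>v. if v \<in> U then a v * h v else 0" and ?p = "\<lambda>v. if v \<in> C - U then \<phi> v h else 0"
    have eq: "diag_plus_functionals U a C \<phi> h = (\<lambda>v. ?d v + ?p v)"
      by (auto simp: diag_plus_functionals_def)
    have "cmod (?d v) \<le> \<bar>B\<bar> * cmod (h v)" for v
      using a[of v] by (auto simp: norm_mult intro!: mult_right_mono)
    moreover have "?d v = 0" if "v \<notin> V" for v
      using that UC(1) by auto
    ultimately have d: "?d \<in> ell2 V" "ell2_norm ?d \<le> \<bar>B\<bar> * ell2_norm h"
      using ell2_dominated[OF h abs_ge_zero[of B], of V ?d] by blast+
    have p: "?p \<in> ell2 V" "ell2_norm ?p \<le> (\<Sum>v\<in>C. cmod (?p v))"
      using ell2_finite_support[OF UC(3,2), of ?p] by auto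
    note p(2)
    also have "(\<Sum>v\<in>C. cmod (?p v)) \<le> (\<Sum>v\<in>C. m v * ell2_norm h)"
      using m h ell2_norm_nonneg[of h] by (intro sum_mono) auto
    finally show ?thesis
      using ell2_triangle[OF d(1) p(1)] d(2) unfolding eq
      by (simp add: distrib_right sum_distrib_right)
  qed
  moreover have "0 \<le> ?M"
    using m(2) by (auto intro!: add_nonneg_nonneg sum_nonneg)
  ultimately show ?thesis by blast
qed

text \<open>A diagonal operator is compact if its weights tend to zero; the finitely many extra
  coordinates do not affect the tails.\<close>

lemma diag_plus_functionals_compact:
  assumes UC: "U \<subseteq> V" "C \<subseteq> V" "finite C"
    and a: "\<And>\<epsilon>. 0 < \<epsilon> \<Longrightarrow> finite {v \<in> U. \<epsilon> < cmod (a v)}"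
    and \<phi>: "\<And>v. v \<in> C \<Longrightarrow> bounded_functional V (\<phi> v)"
  shows "compact_operator V (diag_plus_functionals U a C \<phi>)"
    and "\<exists>M. \<forall>h\<in>ell2 V. ell2_norm (diag_plus_functionals U a C \<phi> h) \<le> M * ell2_norm h"
proof -
  let ?K = "diag_plus_functionals U a C \<phi>"
  have "cmod (a v) \<le> 1 + (\<Sum>w | w \<in> U \<and> 1 < cmod (a w). cmod (a w))" if "v \<in> U" for v
  proof (cases "1 < cmod (a v)")
    case True
    then show ?thesis
      using a[of 1] that member_le_sum[of v "{w \<in> U. 1 < cmod (a w)}" "\<lambda>w. cmod (a w)"] by simp
  next
    case False
    moreover have "0 \<le> (\<Sum>w | w \<in> U \<and> 1 < cmod (a w). cmod (a w))"
      by (intro sum_nonneg) auto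
    ultimately show ?thesis by linarith
  qed
  from diag_plus_functionals_bounded[where a = a and \<phi> = \<phi>, OF UC this \<phi>]
  obtain M where M: "0 \<le> M" "\<And>h. h \<in> ell2 V \<Longrightarrow> ?K h \<in> ell2 V"
    "\<And>h. h \<in> ell2 V \<Longrightarrow> ell2_norm (?K h) \<le> M * ell2_norm h"
    by blast
  then show "\<exists>M. \<forall>h\<in>ell2 V. ell2_norm (?K h) \<le> M * ell2_norm h"
    by blast
  have lin: "?K (\<lambda>v. c * h v + k v) = (\<lambda>v. c * ?K h v + ?K k v)" if "h \<in> ell2 V" "k \<in> ell2 V" for h k c
    using \<phi> that unfolding bounded_functional_def
    by (auto simp: diag_plus_functionals_def algebra_simps)
  have "Metric_space.mtotally_bounded (ell2 V) ell2_dist (?K ` {h \<in> ell2 V. ell2_norm h \<le> 1})"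
  proof (rule totally_bounded_if_small_tails)
    fix x v assume "x \<in> ?K ` {h \<in> ell2 V. ell2_norm h \<le> 1}"
    then obtain h where h: "h \<in> ell2 V" "ell2_norm h \<le> 1" "x = ?K h"
      by blast
    have "cmod (x v) \<le> M * ell2_norm h"
      using cmod_le_ell2_norm[OF M(2)[OF h(1)], of v] M(3)[OF h(1)] h(3) by simp
    also have "\<dots> \<le> M"
      using mult_left_mono[OF h(2) M(1)] by simp
    finally show "cmod (x v) \<le> M" .
  next
    fix \<epsilon> :: real assume \<epsilon>: "0 < \<epsilon>"
    let ?F = "C \<union> {v \<in> U. \<epsilon> < cmod (a v)}"
    have "ell2_norm (restr (- ?F) (?K h)) \<le> \<epsilon>" if h: "h \<in> ell2 V" "ell2_norm h \<le> 1" for h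
    proof -
      have "cmod (restr (- ?F) (?K h) v) \<le> \<epsilon> * cmod (h v)" for v
        using \<epsilon> by (auto simp: restr_def diag_plus_functionals_def norm_mult intro!: mult_right_mono)
      then have "ell2_norm (restr (- ?F) (?K h)) \<le> \<epsilon> * ell2_norm h"
        using \<epsilon> by (intro ell2_dominated(2)[OF h(1), of _ UNIV]) auto
      also have "\<dots> \<le> \<epsilon>"
        using mult_left_mono[OF h(2), of \<epsilon>] \<epsilon> by simp
      finally show ?thesis .
    qed
    then show "\<exists>F. finite F \<and> (\<forall>x\<in>?K ` {h \<in> ell2 V. ell2_norm h \<le> 1}. ell2_norm (restr (- F) x) \<le> \<epsilon>)"
      using UC(3) a[OF \<epsilon>] by (intro exI[of _ ?F]) auto
  qed (use M(2) in auto)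
  with M(2) lin show "compact_operator V ?K"
    by (auto simp: compact_operator_iff_totally_bounded)
qed

lemma compact_operator_cong:
  assumes "\<And>h. h \<in> ell2 V \<Longrightarrow> K h = K' h"
  shows "compact_operator V K \<longleftrightarrow> compact_operator V K'"
proof -
  have "(\<lambda>v. c * h v + k v) \<in> ell2 V" if "h \<in> ell2 V" "k \<in> ell2 V" for h k c
    using ell2_triangle(1)[OF ell2_scale(1)[OF that(1)] that(2)] .
  moreover have "K ` ell2 V = K' ` ell2 V"
    "K ` {h \<in> ell2 V. ell2_norm h \<le> 1} = K' ` {h \<in> ell2 V. ell2_norm h \<le> 1}"
    using assms by (auto intro!: image_cong)
  ultimately show ?thesis
    using assms unfolding compact_operator_def by (simp cong: ball_cong)
qed


section \<open>The operator \<open>W\<^bsub>f,g\<^esub>\<close> and its resolvent\<close>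

locale rank_one_extension =
  fixes V :: "'a set" and E :: "('a \<times> 'a) set" and u b :: 'a and lam f g :: "'a \<Rightarrow> complex"
  assumes U_subset: "U_set E u b \<subseteq> V"
    and finite_A: "finite (A_set E u b)"
    and A_subset: "A_set E u b \<subseteq> V - U_set E u b"
    and u_in_A: "u \<in> A_set E u b"
    and f_ell2: "f \<in> ell2 (V - U_set E u b)"
begin

abbreviation "U \<equiv> U_set E u b"
abbreviation "A \<equiv> A_set E u b"
abbreviation "W \<equiv> W_op V E u b lam f g"

text \<open>Both the domain and the action of \<open>W - z\<close> can be read off the coordinates of a single vector
  \<open>x\<close> of \<open>\<ell>\<^sup>2(V)\<close>, without splitting it into its components in \<open>\<ell>\<^sup>2(U)\<close> and its complement.\<close>

lemma op_dom_W:
  "op_dom W = {x \<in> ell2 V. restr U (\<lambda>v. lam v * x v) \<in> ell2 U \<and> (\<lambda>v. x v * cnj (g v)) summable_on U}"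
  (is "_ = ?D")
proof (intro equalityI subsetI)
  fix x assume "x \<in> op_dom W"
  then obtain h k where x: "x = (\<lambda>v. h v + k v)" and h: "h \<in> ell2 U" "(\<lambda>v. lam v * h v) \<in> ell2 U"
    "(\<lambda>v. h v * cnj (g v)) summable_on U" and k: "k \<in> ell2 (V - U)"
    by (auto simp: W_op_def diag_op_def oslash_op_def Let_def ell2_ominus[OF U_subset])
  have xh: "x v = h v" if "v \<in> U" for v
    using k that by (simp add: x ell2_def)
  have "x \<in> ell2 V"
    unfolding x using h(1) k ell2_mono[OF U_subset] ell2_mono[of "V - U" V]
    by (intro ell2_triangle(1)) auto
  moreover have "restr U (\<lambda>v. lam v * x v) = (\<lambda>v. lam v * h v)"
    using xh h(2) by (auto simp: restr_def ell2_def)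
  moreover have "(\<lambda>v. x v * cnj (g v)) summable_on U"
    using h(3) xh by (simp cong: summable_on_cong)
  ultimately show "x \<in> ?D"
    using h(2) by simp
next
  fix x assume x: "x \<in> ?D"
  have "x = (\<lambda>v. restr U x v + restr (- U) x v)"
    by (auto simp: restr_def)
  moreover have "restr U x \<in> ell2 U" "restr (- U) x \<in> ell2 (V - U)"
    using restr_ell2(1)[of x V U] restr_ell2(1)[of x V "- U"] x U_subset
    by (auto simp: Int_absorb2 Int_absorb1 Diff_eq Int_commute)
  moreover have "(\<lambda>v. lam v * restr U x v) = restr U (\<lambda>v. lam v * x v)"
    by (auto simp: restr_def)
  moreover have "(\<lambda>v. restr U x v * cnj (g v)) summable_on U"
    using x by (simp add: restr_def cong: summable_on_cong)
  ultimately show "x \<in> op_dom W"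
    using x unfolding W_op_def Let_def ell2_ominus[OF U_subset]
    by (simp only: diag_op_def oslash_op_def operator.simps mem_Collect_eq Int_iff)
      (rule exI[of _ "restr U x"], rule exI[of _ "restr (- U) x"], simp)
qed

lemma f_zero: "v \<in> U \<Longrightarrow> f v = 0"
  using f_ell2 by (auto simp: ell2_def)

lemma u_notin_U: "u \<notin> U"
  using u_in_A A_subset by blast

lemma op_shift_W:
  "op_shift W z x v =
     (if v \<in> U then (lam v - z) * x v
      else (\<Sum>\<^sub>\<infinity>w\<in>U. x w * cnj (g w)) * f v + (if v = u then \<Sum>w\<in>A. lam w * x w else 0) - z * x v)"
proof -
  have "ell2_inner (restr (- U) x) (weight_vec lam A) = (\<Sum>w\<in>A. restr (- U) x w * cnj (weight_vec lam A w))"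
    unfolding ell2_inner_def using finite_A
    by (intro infsum_eq_sum_if_supported) (auto simp: weight_vec_def)
  also have "\<dots> = (\<Sum>w\<in>A. lam w * x w)"
    using A_subset by (intro sum.cong) (auto simp: restr_def weight_vec_def)
  finally have N: "N_op E u b lam (restr (- U) x) v = (if v = u then \<Sum>w\<in>A. lam w * x w else 0)"
    by (simp add: N_op_def rank_one_def basis_vec_def)
  have R: "(\<Sum>\<^sub>\<infinity>w\<in>U. restr U x w * cnj (g w)) = (\<Sum>\<^sub>\<infinity>w\<in>U. x w * cnj (g w))"
    by (intro infsum_cong) (simp add: restr_def)
  have "restr U x v = (if v \<in> U then x v else 0)"
    by (simp add: restr_def)
  then show ?thesis
    using u_notin_U f_zero[of v]
    by (auto simp: op_shift_def W_op_def Let_def diag_op_def oslash_op_def N R left_diff_distrib)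
qed

lemma finite_support_in_op_dom_W:
  assumes "finite F" "F \<subseteq> V" "\<And>v. v \<notin> F \<Longrightarrow> x v = 0"
  shows "x \<in> op_dom W"
proof -
  have "x \<in> ell2 V"
    by (rule ell2_finite_support(1)[OF assms(1,2)]) (rule assms(3))
  moreover have "restr U (\<lambda>v. lam v * x v) \<in> ell2 U"
    using assms(1,3) by (intro ell2_finite_support(1)[of "F \<inter> U"]) (auto simp: restr_def)
  moreover have "(\<lambda>v. x v * cnj (g v)) summable_on U"
  proof -
    have "(\<lambda>v. x v * cnj (g v)) summable_on F \<inter> U"
      using assms(1) by (intro summable_on_finite) auto
    then show ?thesis
      using assms(3) by (subst summable_on_cong_neutral[where T = "F \<inter> U" and g = "\<lambda>v. x v * cnj (g v)"]) auto
  qed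
  ultimately show ?thesis
    by (simp add: op_dom_W)
qed

text \<open>The domain contains all finitely supported vectors, and the tails of a square summable
  family are small.\<close>

lemma densely_defined_W: "densely_defined V W"
proof -
  interpret Metric_space "ell2 V" ell2_dist by (rule Metric_space_ell2)
  have "\<exists>y\<in>op_dom W. y \<in> mball x r" if x: "x \<in> ell2 V" and r: "0 < r" for x r
  proof -
    obtain F where F: "finite F" "ell2_norm (restr (- F) x) < r"
      using ell2_small_tail[OF x r] .
    let ?y = "restr F x"
    have "?y \<in> op_dom W"
      using F(1) x by (intro finite_support_in_op_dom_W[of "F \<inter> V"]) (auto simp: restr_def ell2_def)
    moreover have "(\<lambda>v. x v - ?y v) = restr (- F) x"
      by (auto simp: restr_def)
    then have "?y \<in> mball x r"
      using F(2) x restr_ell2(2)[OF x] by (simp add: in_mball ell2_dist_def)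
    ultimately show ?thesis by blast
  qed
  then have "mtopology closure_of op_dom W = ell2 V"
    by (auto simp: metric_closure_of)
  then show ?thesis
    by (auto simp: densely_defined_def ell2_topology_def op_dom_W)
qed

text \<open>\<open>U\<close> must have finite complement because \<open>W - z\<close> acts as \<open>- z\<close> on the unit vectors outside the
  finite set \<open>A\<close> and \<open>U\<close>, and the weights must have no finite accumulation because the resolvent
  maps \<open>e\<^sub>v\<close> for \<open>v \<in> U\<close> to a vector whose only nonzero coordinate in \<open>U\<close> is \<open>1 / (lam v - z)\<close>.
  Infinitely many vectors of either kind would have images that are uniformly separated.\<close>

context
  fixes z
  assumes z: "z \<in> resolvent_set V W" and compact: "compact_operator V (resolvent W z)"
begin

lemma bij_shift: "bij_betw (op_shift W z) (op_dom W) (ell2 V)"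
  using z by (simp add: resolvent_set_def)

lemma resolvent_shift: "x \<in> op_dom W \<Longrightarrow> resolvent W z (op_shift W z x) = x"
  using bij_shift by (simp add: resolvent_def bij_betw_def)

lemma shift_resolvent:
  "y \<in> ell2 V \<Longrightarrow> resolvent W z y \<in> op_dom W \<and> op_shift W z (resolvent W z y) = y"
  using bij_shift unfolding resolvent_def bij_betw_def
  by (metis f_inv_into_f inv_into_into)

lemma finite_complement: "finite (V - U)"
proof (rule ccontr)
  assume inf: "infinite (V - U)"
  \<comment> \<open>Removing \<open>A\<close>, which contains \<open>u\<close>, leaves coordinates on which \<open>N\<close> vanishes.\<close>
  define I where "I = V - U - A"
  have I: "infinite I" "I \<subseteq> V - U - A"
    using inf finite_A by (auto simp: I_def)
  have supp: "(\<lambda>w. c * basis_vec v w) \<in> op_dom W" if "v \<in> I" for v c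
    using that I(2) by (intro finite_support_in_op_dom_W[of "{v}"]) (auto simp: basis_vec_def)
  have shift: "op_shift W z (\<lambda>w. c * basis_vec v w) = (\<lambda>w. - z * c * basis_vec v w)" if "v \<in> I" for v c
  proof
    fix x
    have "v \<notin> U" "v \<notin> A"
      using that I(2) by auto
    then have "(\<Sum>\<^sub>\<infinity>w\<in>U. c * basis_vec v w * cnj (g w)) = 0" "(\<Sum>w\<in>A. lam w * (c * basis_vec v w)) = 0"
      by (auto intro!: infsum_0 sum.neutral simp: basis_vec_def)
    then show "op_shift W z (\<lambda>w. c * basis_vec v w) x = - z * c * basis_vec v x"
      using \<open>v \<notin> U\<close> by (auto simp: op_shift_W basis_vec_def)
  qed
  have "z \<noteq> 0"
  proof
    assume "z = 0"
    obtain v where v: "v \<in> I"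
      using I(1) by (metis ex_in_conv finite.emptyI)
    have "op_shift W z (\<lambda>w. 1 * basis_vec v w) = op_shift W z (\<lambda>w. 0 * basis_vec v w)"
      unfolding shift[OF v] using \<open>z = 0\<close> by simp
    then have "(\<lambda>w. 1 * basis_vec v w) = (\<lambda>w. 0 * basis_vec v w)"
      using bij_shift supp[OF v] unfolding bij_betw_def inj_on_def by blast
    then have "1 * basis_vec v v = 0 * basis_vec v v"
      by (rule fun_cong)
    then show False
      by (simp add: basis_vec_def)
  qed
  have res: "resolvent W z (basis_vec v) = (\<lambda>w. - (1 / z) * basis_vec v w)" if "v \<in> I" for v
    using resolvent_shift[OF supp[OF that, of "- (1 / z)"]] shift[OF that, of "- (1 / z)"] \<open>z \<noteq> 0\<close>
    by simp
  have "finite I"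
  proof (rule compact_operator_separated_finite[OF compact, where y = basis_vec and t = "1 / cmod z"])
    fix v assume "v \<in> I"
    then show "basis_vec v \<in> ell2 V" "ell2_norm (basis_vec v) \<le> 1"
      using I(2) ell2_finite_support[of "{v}" V "basis_vec v"] by (auto simp: basis_vec_def)
  next
    fix v w assume "v \<in> I" "w \<in> I" "v \<noteq> w"
    then have "resolvent W z (basis_vec v) v = - (1 / z)" "resolvent W z (basis_vec w) v = 0"
      by (simp_all only: res) (simp_all add: basis_vec_def)
    then show "1 / cmod z \<le> cmod (resolvent W z (basis_vec v) v - resolvent W z (basis_vec w) v)"
      by (simp add: norm_divide)
  qed (use \<open>z \<noteq> 0\<close> in simp)
  with I(1) show False by blast
qed

lemma resolvent_basis_vec:
  assumes "v \<in> U" "w \<in> U"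
  shows "lam v \<noteq> z" "resolvent W z (basis_vec v) w = (if w = v then 1 / (lam v - z) else 0)"
proof -
  have coord: "(lam w' - z) * resolvent W z (basis_vec v') w' = basis_vec v' w'"
    if "v' \<in> U" "w' \<in> U" for v' w'
  proof -
    have "basis_vec v' \<in> ell2 V"
      using that U_subset by (intro ell2_finite_support(1)[of "{v'}"]) (auto simp: basis_vec_def)
    then have "op_shift W z (resolvent W z (basis_vec v')) w' = basis_vec v' w'"
      using shift_resolvent by simp
    then show ?thesis
      using that by (simp add: op_shift_W)
  qed
  have ne: "lam v' \<noteq> z" if "v' \<in> U" for v'
    using coord[OF that that] by (auto simp: basis_vec_def)
  then show "lam v \<noteq> z"
    using assms by blast
  show "resolvent W z (basis_vec v) w = (if w = v then 1 / (lam v - z) else 0)"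
    using coord[OF assms] ne[OF assms(2)] by (auto simp: basis_vec_def field_simps split: if_splits)
qed

lemma finite_bounded_weights: "finite {v \<in> U. cmod (lam v) \<le> r}"
proof (rule compact_operator_separated_finite[OF compact, where y = basis_vec
      and t = "1 / (\<bar>r\<bar> + cmod z + 1)"])
  fix v assume "v \<in> {v \<in> U. cmod (lam v) \<le> r}"
  then show "basis_vec v \<in> ell2 V" "ell2_norm (basis_vec v) \<le> 1"
    using U_subset ell2_finite_support[of "{v}" V "basis_vec v"] by (auto simp: basis_vec_def)
next
  fix v w assume v: "v \<in> {v \<in> U. cmod (lam v) \<le> r}" and w: "w \<in> {v \<in> U. cmod (lam v) \<le> r}"
    and "v \<noteq> w"
  have "cmod (lam v - z) \<le> \<bar>r\<bar> + cmod z + 1"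
    using v norm_triangle_ineq4[of "lam v" z] abs_ge_self[of r] by auto
  moreover have "0 < cmod (lam v - z)"
    using resolvent_basis_vec(1)[of v v] v by simp
  ultimately have "1 / (\<bar>r\<bar> + cmod z + 1) \<le> 1 / cmod (lam v - z)"
    using norm_ge_zero[of z] by (intro divide_left_mono mult_pos_pos) linarith+
  then show "1 / (\<bar>r\<bar> + cmod z + 1) \<le> cmod (resolvent W z (basis_vec v) v - resolvent W z (basis_vec w) v)"
    using resolvent_basis_vec(2)[of v v] resolvent_basis_vec(2)[of w v] v w \<open>v \<noteq> w\<close>
    by (simp add: norm_divide)
next
  show "0 < 1 / (\<bar>r\<bar> + cmod z + 1)"
    using norm_ge_zero[of z] by (intro divide_pos_pos) linarith+
qed

end

text \<open>Solving \<open>(W - z) x = y\<close> coordinatewise: on \<open>U\<close> by division, then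
  \<open>(N - z) k = y - L y f\<close> on the rest, where \<open>L y\<close> is the value of \<open>f \<oslash> g\<close> on the first part and
  \<open>c\<close> is the value of the functional \<open>\<Sum>w\<in>A. lam w * k w\<close> that defines \<open>N\<close>.\<close>

context
  fixes z \<delta> q L c G
  assumes \<delta>: "0 < \<delta>" and far: "\<And>v. v \<in> U \<Longrightarrow> \<delta> \<le> cmod (lam v - z)"
    and z: "z \<noteq> 0" "z \<noteq> lam u"
  defines "q \<equiv> restr U (\<lambda>v. g v / cnj (lam v - z))"
  defines "L y \<equiv> ell2_inner y q"
  defines "c y \<equiv> (\<Sum>w\<in>A. lam w * (y w - L y * f w)) / (lam u - z)"
  defines "G \<equiv> diag_plus_functionals U (\<lambda>v. 1 / (lam v - z)) (V - U)
    (\<lambda>v y. (1 / z) * ((if v = u then c y else 0) + (- 1) * y v + f v * L y))"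
  assumes q: "q \<in> ell2 V"
begin

lemma L_eq: "L y = (\<Sum>\<^sub>\<infinity>w\<in>U. y w / (lam w - z) * cnj (g w))"
  unfolding L_def ell2_inner_def q_def
  by (rule infsum_cong_neutral) (auto simp: restr_def)

lemma bounded_functional_L: "bounded_functional V L"
  unfolding L_def using q by (rule bounded_functional_inner)

lemma bounded_functional_c: "bounded_functional V c"
proof -
  have eq: "c = (\<lambda>y. (1 / (lam u - z)) * (\<Sum>w\<in>A. lam w * (y w + (- f w) * L y)))"
    by (auto simp: c_def mult.commute)
  show ?thesis
    unfolding eq
    by (intro bounded_functional_scale bounded_functional_sum bounded_functional_add
        bounded_functional_coord bounded_functional_L)
qed

lemma
  assumes fin: "finite (V - U)" and weights: "\<And>r. finite {v \<in> U. cmod (lam v) \<le> r}"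
  shows compact_G: "compact_operator V G"
    and bounded_G: "\<exists>M. \<forall>h\<in>ell2 V. ell2_norm (G h) \<le> M * ell2_norm h"
proof -
  have "finite {v \<in> U. \<epsilon> < cmod (1 / (lam v - z))}" if "0 < \<epsilon>" for \<epsilon>
  proof (rule finite_subset[OF _ weights])
    show "{v \<in> U. \<epsilon> < cmod (1 / (lam v - z))} \<subseteq> {v \<in> U. cmod (lam v) \<le> 1 / \<epsilon> + cmod z}"
    proof safe
      fix v assume v: "v \<in> U" "\<epsilon> < cmod (1 / (lam v - z))"
      have "0 < cmod (lam v - z)"
        using far[OF v(1)] \<delta> by linarith
      then have "cmod (lam v - z) \<le> 1 / \<epsilon>"
        using v(2) that by (simp add: norm_divide field_simps)
      then show "cmod (lam v) \<le> 1 / \<epsilon> + cmod z"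
        using norm_triangle_ineq2[of "lam v" z] by linarith
    qed
  qed
  moreover have "bounded_functional V (\<lambda>y. if v = u then c y else 0)" for v
    using bounded_functional_c bounded_functional_zero by (cases "v = u") simp_all
  then have "bounded_functional V
      (\<lambda>y. (1 / z) * ((if v = u then c y else 0) + (- 1) * y v + f v * L y))" for v
    by (intro bounded_functional_scale bounded_functional_add
        bounded_functional_coord bounded_functional_L)
  ultimately show "compact_operator V G" "\<exists>M. \<forall>h\<in>ell2 V. ell2_norm (G h) \<le> M * ell2_norm h"
    unfolding G_def using fin U_subset by (intro diag_plus_functionals_compact; blast)+
qed

lemma lam_ne_z: "v \<in> U \<Longrightarrow> lam v \<noteq> z"
  using far[of v] \<delta> by auto

lemma G_in_op_dom:
  assumes "G y \<in> ell2 V" "y \<in> ell2 V"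
  shows "G y \<in> op_dom W"
proof -
  have GU: "G y v = y v / (lam v - z)" if "v \<in> U" for v
    using that by (simp add: G_def diag_plus_functionals_def)
  \<comment> \<open>\<open>D\<close> need not be bounded, but \<open>D (D - z)\<inverse> = 1 + z (D - z)\<inverse>\<close>.\<close>
  have eq: "restr U (\<lambda>v. lam v * G y v) = (\<lambda>v. restr U y v + z * restr U (G y) v)"
    using lam_ne_z by (auto simp: restr_def GU field_simps)
  have "restr U y \<in> ell2 U" "restr U (G y) \<in> ell2 U"
    using restr_ell2(1)[OF assms(2), of U] restr_ell2(1)[OF assms(1), of U] U_subset
    by (auto simp: Int_absorb2)
  then have "restr U (\<lambda>v. lam v * G y v) \<in> ell2 U"
    unfolding eq by (intro ell2_triangle(1) ell2_scale(1))
  moreover have "(\<lambda>v. G y v * cnj (g v)) summable_on U"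
  proof -
    have "(\<lambda>v. y v * cnj (q v)) summable_on UNIV"
      by (rule ell2_Cauchy_Schwarz(1)[OF assms(2) q])
    then have "(\<lambda>v. y v * cnj (q v)) summable_on U"
      by (rule summable_on_subset) simp
    then show ?thesis
      by (rule summable_on_cong[THEN iffD1, rotated]) (simp add: GU q_def restr_def)
  qed
  ultimately show ?thesis
    using assms(1) by (simp add: op_dom_W)
qed

lemma shift_G:
  assumes "y \<in> ell2 V"
  shows "op_shift W z (G y) = y"
proof
  have GU: "G y v = y v / (lam v - z)" if "v \<in> U" for v
    using that by (simp add: G_def diag_plus_functionals_def)
  have GC: "z * G y v = (if v = u then c y else 0) - y v + f v * L y" if "v \<in> V" "v \<notin> U" for v
    using that z(1) by (simp add: G_def diag_plus_functionals_def)
  have G0: "G y v = 0" if "v \<notin> V" for v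
    using that U_subset by (auto simp: G_def diag_plus_functionals_def)
  have LG: "(\<Sum>\<^sub>\<infinity>w\<in>U. G y w * cnj (g w)) = L y"
    unfolding L_eq by (intro infsum_cong) (simp add: GU)
  \<comment> \<open>Consistency of \<open>c\<close>: applying the functional to the formula for \<open>G y\<close> on \<open>A\<close> gives back \<open>c y\<close>.\<close>
  have "z * (\<Sum>w\<in>A. lam w * G y w) = (\<Sum>w\<in>A. lam w * (z * G y w))"
    by (simp add: sum_distrib_left mult_ac)
  also have "\<dots> = (\<Sum>w\<in>A. (if w = u then lam w * c y else 0) - lam w * (y w - L y * f w))"
  proof (rule sum.cong)
    fix w assume "w \<in> A"
    then have "w \<in> V" "w \<notin> U"
      using A_subset by auto
    from GC[OF this]
    show "lam w * (z * G y w) = (if w = u then lam w * c y else 0) - lam w * (y w - L y * f w)"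
      by (simp only:) (simp add: algebra_simps)
  qed simp
  also have "\<dots> = lam u * c y - (\<Sum>w\<in>A. lam w * (y w - L y * f w))"
    using u_in_A finite_A by (simp add: sum_subtractf)
  also have "(\<Sum>w\<in>A. lam w * (y w - L y * f w)) = (lam u - z) * c y"
    using z(2) by (simp add: c_def)
  finally have "z * (\<Sum>w\<in>A. lam w * G y w) = z * c y"
    by (simp add: algebra_simps)
  then have cG: "(\<Sum>w\<in>A. lam w * G y w) = c y"
    using z(1) by simp
  fix v
  consider "v \<in> U" | "v \<in> V" "v \<notin> U" | "v \<notin> V"
    by blast
  then show "op_shift W z (G y) v = y v"
  proof cases
    case 1
    then show ?thesis using lam_ne_z by (simp add: op_shift_W GU)
  next
    case 2
    then show ?thesis using GC[OF 2] by (simp add: op_shift_W LG cG)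
  next
    case 3
    then have "v \<notin> U" "v \<noteq> u" "f v = 0" "y v = 0"
      using U_subset u_in_A A_subset f_ell2 assms by (auto simp: ell2_def)
    then show ?thesis using G0[OF 3] by (simp add: op_shift_W)
  qed
qed

lemma G_shift:
  assumes "x \<in> op_dom W"
  shows "G (op_shift W z x) = x"
proof
  let ?y = "op_shift W z x"
  have L: "L ?y = (\<Sum>\<^sub>\<infinity>w\<in>U. x w * cnj (g w))"
    unfolding L_eq by (intro infsum_cong) (use lam_ne_z in \<open>simp add: op_shift_W\<close>)
  have "(\<Sum>w\<in>A. lam w * (?y w - L ?y * f w)) =
      (\<Sum>w\<in>A. (if w = u then lam w * (\<Sum>w\<in>A. lam w * x w) else 0) - z * (lam w * x w))"
    using A_subset by (intro sum.cong) (auto simp: op_shift_W L algebra_simps)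
  also have "\<dots> = lam u * (\<Sum>w\<in>A. lam w * x w) - z * (\<Sum>w\<in>A. lam w * x w)"
    using u_in_A finite_A by (simp add: sum_subtractf sum_distrib_left)
  finally have c: "c ?y = (\<Sum>w\<in>A. lam w * x w)"
    using z(2) by (simp add: c_def left_diff_distrib[symmetric])
  fix v
  consider "v \<in> U" | "v \<in> V" "v \<notin> U" | "v \<notin> V"
    by blast
  then show "G ?y v = x v"
  proof cases
    case 1
    then show ?thesis using lam_ne_z by (simp add: G_def diag_plus_functionals_def op_shift_W)
  next
    case 2
    have "?y v = L ?y * f v + (if v = u then c ?y else 0) - z * x v"
      using 2 by (simp add: op_shift_W L c)
    then show ?thesis
      using 2 z(1) by (auto simp: G_def diag_plus_functionals_def)
  next
    case 3
    then show ?thesis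
      using assms U_subset by (auto simp: G_def diag_plus_functionals_def op_dom_W ell2_def)
  qed
qed

lemma shift_in_ell2:
  assumes "x \<in> op_dom W"
  shows "op_shift W z x \<in> ell2 V"
proof -
  have x: "x \<in> ell2 V" "restr U (\<lambda>v. lam v * x v) \<in> ell2 U"
    using assms by (auto simp: op_dom_W)
  let ?s = "\<Sum>\<^sub>\<infinity>w\<in>U. x w * cnj (g w)" and ?t = "\<Sum>w\<in>A. lam w * x w"
  have "op_shift W z x =
      (\<lambda>v. (restr U (\<lambda>v. lam v * x v) v + (- z) * x v) + (?s * f v + ?t * basis_vec u v))"
    using f_zero u_notin_U by (auto simp: op_shift_W restr_def basis_vec_def algebra_simps)
  moreover have "basis_vec u \<in> ell2 V"
    using u_in_A A_subset by (intro ell2_finite_support(1)[of "{u}"]) (auto simp: basis_vec_def)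
  moreover have "f \<in> ell2 V" "restr U (\<lambda>v. lam v * x v) \<in> ell2 V"
    using f_ell2 x(2) ell2_mono[of "V - U" V] ell2_mono[OF U_subset] by auto
  ultimately show ?thesis
    using x(1) by (simp only:) (intro ell2_triangle(1) ell2_scale(1); assumption)
qed

lemma compact_resolvent_at:
  assumes "finite (V - U)" "\<And>r. finite {v \<in> U. cmod (lam v) \<le> r}"
  shows "admits_compact_resolvent V W"
proof -
  have GV: "G y \<in> ell2 V" if "y \<in> ell2 V" for y
    using compact_G[OF assms] that by (auto simp: compact_operator_def)
  have bij: "bij_betw (op_shift W z) (op_dom W) (ell2 V)"
    by (rule bij_betw_byWitness[where f' = G])
      (use G_shift shift_G shift_in_ell2 G_in_op_dom GV in auto)
  have res: "resolvent W z y = G y" if "y \<in> ell2 V" for y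
    unfolding resolvent_def using bij G_in_op_dom GV shift_G that
    by (intro inv_into_f_eq) (auto simp: bij_betw_def)
  have "z \<in> resolvent_set V W"
    using bij bounded_G[OF assms] res by (simp add: resolvent_set_def)
  moreover have "compact_operator V (resolvent W z)"
    using compact_G[OF assms] compact_operator_cong[of V "resolvent W z" G] res by blast
  ultimately show ?thesis
    using densely_defined_W by (auto simp: admits_compact_resolvent_def spectrum_def)
qed

end

text \<open>Near \<open>\<mu>\<^sub>0\<close> all points stay at a positive distance from the weights with a summability condition
  comparable to the one at \<open>\<mu>\<^sub>0\<close>, and all but two of them avoid \<open>0\<close> and \<open>lam u\<close>, the only possible
  eigenvalues of \<open>N\<close>.\<close>

lemma compact_resolvent_if:
  assumes comp: "compatibility_I U lam g"
    and fin: "finite (V - U)" and weights: "\<And>r. finite {v \<in> U. cmod (lam v) \<le> r}"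
  shows "admits_compact_resolvent V W"
proof -
  obtain \<mu> where \<mu>: "(INF v\<in>U. cmod (\<mu> - lam v)) > 0"
    "(\<lambda>v. (cmod (g v))\<^sup>2 / (cmod (lam v - \<mu>))\<^sup>2) summable_on U"
    using comp by (auto simp: compatibility_I_def)
  obtain d where d: "0 < d" "\<And>v. v \<in> U \<Longrightarrow> d \<le> cmod (lam v - \<mu>)"
  proof
    show "(INF v\<in>U. cmod (\<mu> - lam v)) \<le> cmod (lam v - \<mu>)" if "v \<in> U" for v
    proof -
      have "bdd_below ((\<lambda>v. cmod (\<mu> - lam v)) ` U)"
        by (rule bdd_belowI2[of _ 0]) simp
      then show ?thesis
        using cINF_lower[of "\<lambda>v. cmod (\<mu> - lam v)" U v] that by (simp add: norm_minus_commute)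
    qed
  qed (rule \<mu>(1))
  \<comment> \<open>Radius \<open>d / 2\<close>: every weight is then at most twice as far from \<open>\<mu>\<close> as from \<open>z\<close>.\<close>
  have "infinite (ball \<mu> (d / 2) - {0, lam u})"
    using d(1) using uncountable_ball[of "d / 2" \<mu>] uncountable_infinite by (intro Diff_infinite_finite) auto
  then obtain z where z: "dist \<mu> z < d / 2" "z \<noteq> 0" "z \<noteq> lam u"
    by (metis Diff_iff ex_in_conv finite.emptyI insertI1 insertI2 mem_ball)
  have half: "cmod (lam v - \<mu>) / 2 \<le> cmod (lam v - z)" if "v \<in> U" for v
    using norm_triangle_ineq[of "lam v - z" "z - \<mu>"] d(2)[OF that] z(1)
    by (simp add: dist_norm norm_minus_commute)
  have "restr U (\<lambda>v. g v / cnj (lam v - z)) \<in> ell2 V"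
  proof -
    have "(\<lambda>v. 4 * ((cmod (g v))\<^sup>2 / (cmod (lam v - \<mu>))\<^sup>2)) summable_on U"
      using \<mu>(2) by (rule summable_on_cmult_right)
    then have "(\<lambda>v. (cmod (g v / cnj (lam v - z)))\<^sup>2) summable_on U"
    proof (rule summable_on_comparison_test)
      fix v assume v: "v \<in> U"
      have "(cmod (lam v - \<mu>) / 2)\<^sup>2 \<le> (cmod (lam v - z))\<^sup>2"
        using half[OF v] by (intro power_mono) auto
      moreover have "0 < (cmod (lam v - \<mu>) / 2)\<^sup>2"
        using d(1) d(2)[OF v] by auto
      ultimately have "(cmod (g v))\<^sup>2 / (cmod (lam v - z))\<^sup>2 \<le> (cmod (g v))\<^sup>2 / (cmod (lam v - \<mu>) / 2)\<^sup>2"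
        by (intro divide_left_mono mult_pos_pos) auto
      then show "(cmod (g v / cnj (lam v - z)))\<^sup>2 \<le> 4 * ((cmod (g v))\<^sup>2 / (cmod (lam v - \<mu>))\<^sup>2)"
        by (simp add: norm_divide power_divide mult.commute del: complex_cnj_diff)
    qed auto
    then have "(\<lambda>v. (cmod (restr U (\<lambda>v. g v / cnj (lam v - z)) v))\<^sup>2) summable_on UNIV"
      by (rule summable_on_cong_neutral[THEN iffD1, rotated -1]) (auto simp: restr_def)
    then show ?thesis
      using U_subset by (auto simp: ell2_def restr_def)
  qed
  then show ?thesis
    using compact_resolvent_at[of "d / 2" z] d half z fin weights by force
qed

lemma compact_resolvent_iff:
  assumes "compatibility_I U lam g"
  shows "admits_compact_resolvent V W \<longleftrightarrow>
    finite (V - U) \<and> (\<forall>r. finite {v \<in> U. cmod (lam v) \<le> r})"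
  using compact_resolvent_if[OF assms] finite_complement finite_bounded_weights
  by (auto simp: admits_compact_resolvent_def spectrum_def)

end

text \<open>By the Bolzano--Weierstrass theorem, a value set without accumulation points meets each ball in
  finitely many points. This is the form \<open>|lam v| \<longrightarrow> \<infinity>\<close> in which the weights enter the study of
  resolvents.\<close>

lemma no_limpt_finite_fibres_iff:
  fixes \<phi> :: "'a \<Rightarrow> 'b :: {heine_borel, real_normed_vector}"
  shows "(\<forall>z. \<not> z islimpt \<phi> ` U) \<and> (\<forall>z\<in>\<phi> ` U. finite {v \<in> U. \<phi> v = z}) \<longleftrightarrow>
    (\<forall>r. finite {v \<in> U. norm (\<phi> v) \<le> r})"
proof (intro iffI allI conjI ballI)
  fix r
  assume *: "(\<forall>z. \<not> z islimpt \<phi> ` U) \<and> (\<forall>z\<in>\<phi> ` U. finite {v \<in> U. \<phi> v = z})"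
  have "finite (cball 0 r \<inter> \<phi> ` U)"
    using * by (intro finite_not_islimpt_in_compact) auto
  then have "finite (\<Union>z\<in>cball 0 r \<inter> \<phi> ` U. {v \<in> U. \<phi> v = z})"
    using * by (intro finite_UN_I) auto
  then show "finite {v \<in> U. norm (\<phi> v) \<le> r}"
    by (rule rev_finite_subset) auto
next
  fix z :: 'b
  assume *: "\<forall>r. finite {v \<in> U. norm (\<phi> v) \<le> r}"
  have "finite (\<phi> ` {v \<in> U. norm (\<phi> v) \<le> norm z + 1})"
    using * by blast
  then have "finite (\<phi> ` U \<inter> cball z 1)"
  proof (rule rev_finite_subset)
    have "norm (\<phi> v) \<le> norm z + 1" if "dist z (\<phi> v) \<le> 1" for v
      using that norm_triangle_ineq2[of "\<phi> v" z] by (simp add: dist_norm norm_minus_commute)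
    then show "\<phi> ` U \<inter> cball z 1 \<subseteq> \<phi> ` {v \<in> U. norm (\<phi> v) \<le> norm z + 1}"
      by auto
  qed
  then show "\<not> z islimpt \<phi> ` U"
    by (auto simp: islimpt_eq_infinite_cball intro!: exI[of _ 1])
next
  fix z :: 'b
  assume *: "\<forall>r. finite {v \<in> U. norm (\<phi> v) \<le> r}"
  then have "finite {v \<in> U. norm (\<phi> v) \<le> norm z}"
    by blast
  then show "finite {v \<in> U. \<phi> v = z}"
    by (rule rev_finite_subset) auto
qed


section \<open>Compact resolvents and the branching of the tree\<close>

theorem corollary4p20:
  fixes V :: "'a set" and E :: "('a \<times> 'a) set" and u b :: 'a
    and lam f g :: "'a \<Rightarrow> complex"
  assumes "rooted_directed_tree V E"
    and "countable V" and "infinite V"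
    and "u \<in> V" and "b \<in> V - {u}"
    and "f \<in> ell2 V \<ominus> ell2 (U_set E u b)" and "f \<noteq> (\<lambda>v. 0)"
    and "compatibility_I (U_set E u b) lam g"
    and "leafless V E"
  shows "admits_compact_resolvent V (W_op V E u b lam f g) \<longleftrightarrow>
    (\<forall>z. \<not> z islimpt lam ` U_set E u b) \<and>
    (\<forall>z\<in>lam ` U_set E u b. finite {v \<in> U_set E u b. lam v = z}) \<and>
    branching V E \<inter> Asc E u = {}"
proof -
  interpret rooted_directed_tree V E by (rule assms(1))
  have b: "b \<in> V"
    using assms(5) by blast
  interpret rank_one_extension V E u b lam f g
    using U_set_subset[OF assms(4)] finite_A_set[OF assms(4) b] A_set_subset[OF assms(4) b]
      u_in_A_set assms(6) ell2_ominus[OF U_set_subset[OF assms(4)]]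
    by unfold_locales auto
  show ?thesis
    using compact_resolvent_iff[OF assms(8)] no_limpt_finite_fibres_iff[of lam "U_set E u b"]
      finite_complement_U_set_iff[OF assms(9,4) b] by satx
qed

end
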